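(* Let $\Sigma$ be a finite ranked set. If a language $L\subseteq\mathsf{H}_0\Sigma$ is definable in counting $\mathrm{MSO}_2$, then it is recognised by a computable $\mathsf{H}$-algebra that is finite on every arity.
   Context: A ranked set is a set in which each element has an arity in $\{0,1,2,\dots\}$. A sourced hypergraph of arity $n$ over $\Sigma$: finite vertex set, finite ranked set of hyperedges labelled arity-preservingly by $\Sigma$, incidence mapping each $m$-ary hyperedge $e$ to a non-repeating list $e[1],\dots,e[m]$ of vertices, injective sources $\{1,\dots,n\}\to$ vertices. $\mathsf{H}\Sigma$: these up to isomorphism; $\mathsf{H}_0\Sigma$: arity 0. Unit of $n$-ary $a$: vertices $1..n$ as sources, one hyperedge labelled $a$ with incidence $[1..n]$. Flattening of $G\in\mathsf{H}\mathsf{H}\Sigma$: hyperedges $(e,f)$, $e$ a hyperedge of $G$, $f$ a hyperedge of the label of $e$ (label from $f$); vertices: vertices of $G$ and pairs $(e,v)$, $v$ a non-source vertex of the label of $e$; sources from $G$; incidence of $(e,f)$ is that of $f$ with $v\mapsto(e,v)$ for non-sources and $v\mapsto e[i]$ for the $i$-th source. An $\mathsf{H}$-algebra is a ranked set $A$ with arity-preserving $\pi:\mathsf{H}A\to A$, $\pi(\mathrm{unit}\,a)=a$, $\pi\circ\mathsf{H}\pi=\pi\circ\mathrm{flatten}$; homomorphisms commute with products. $L$ is recognised by $\mathcal{A}$ if $L=h^{-1}(F)\cap\mathsf{H}_0\Sigma$ for a homomorphism $h:\mathsf{H}\Sigma\to\mathcal{A}$ and a set $F$. An $\mathsf{H}$-algebra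 with universe $A$ is computable if its elements can be represented finitely (e.g. as strings) so that there are algorithms that (1) given an arity $n$ and $i\ge1$, compute the $i$-th $n$-ary element or report that there are fewer than $i$ of them; (2) given an element of $\mathsf{H}A$, compute its product. The $\mathrm{MSO}_2$ model of $G\in\mathsf{H}\Sigma$: universe is the disjoint union of vertices and hyperedges; for each $a\in\Sigma$ a unary relation for hyperedges labelled $a$; for each $i$ up to the maximal arity in $\Sigma$ a binary relation $\{(e,v): e[i]=v\}$; for each $i$ up to the arity of $G$ a constant for the $i$-th source. Counting MSO is MSO extended with predicates $|X|\equiv k \bmod m$ (true if $X$ is finite with size $\equiv k$ mod $m$). $L$ is definable in counting $\mathrm{MSO}_2$ if $L=\{G\in\mathsf{H}_0\Sigma : \text{model of } G\models\varphi\}$ for a counting MSO sentence $\varphi$. *)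

theory Defs
  imports Main "HOL-Library.Nat_Bijection"
begin

text \<open>A concrete sourced hypergraph with vertex type 'v, hyperedge type 'e and labels of
type 'a.  The arity of a hyperedge e is the length of its incidence list inc e, the arity
of the hypergraph is the length of its list of sources.  Values of lab/inc outside the
hyperedge set are irrelevant.\<close>

record ('v, 'e, 'a) hg =
  verts :: "'v set"
  edges :: "'e set"
  lab   :: "'e \<Rightarrow> 'a"
  inc   :: "'e \<Rightarrow> 'v list"
  srcs  :: "'v list"

definition wf_hg :: "('a \<Rightarrow> nat) \<Rightarrow> 'a set \<Rightarrow> ('v, 'e, 'a) hg \<Rightarrow> bool" where
  "wf_hg ar S G \<longleftrightarrow>
     finite (verts G) \<and> finite (edges G) \<and>
     (\<forall>e \<in> edges G. lab G e \<in> S \<and> length (inc G e) = ar (lab G e) \<and>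
                     distinct (inc G e) \<and> set (inc G e) \<subseteq> verts G) \<and>
     distinct (srcs G) \<and> set (srcs G) \<subseteq> verts G"

abbreviation hg_arity :: "('v, 'e, 'a) hg \<Rightarrow> nat" where
  "hg_arity G \<equiv> length (srcs G)"

definition hg_iso :: "('v, 'e, 'a) hg \<Rightarrow> ('w, 'f, 'a) hg \<Rightarrow> bool" where
  "hg_iso G H \<longleftrightarrow> (\<exists>fv fe. bij_betw fv (verts G) (verts H) \<and> bij_betw fe (edges G) (edges H) \<and>
      (\<forall>e \<in> edges G. lab H (fe e) = lab G e \<and> inc H (fe e) = map fv (inc G e)) \<and>
      srcs H = map fv (srcs G))"

text \<open>H S (up to isomorphism) is represented by the well-formed hypergraphs with vertices
and hyperedges natural numbers; functions on H S are required to be isomorphism invariant.\<close>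

type_synonym 'a H = "(nat, nat, 'a) hg"

definition hg_unit :: "('a \<Rightarrow> nat) \<Rightarrow> 'a \<Rightarrow> 'a H" where
  "hg_unit ar a = \<lparr> verts = {0..<ar a}, edges = {0}, lab = (\<lambda>_. a),
                     inc = (\<lambda>_. [0..<ar a]), srcs = [0..<ar a] \<rparr>"

definition hg_map :: "('a \<Rightarrow> 'b) \<Rightarrow> ('v, 'e, 'a) hg \<Rightarrow> ('v, 'e, 'b) hg" where
  "hg_map h G = \<lparr> verts = verts G, edges = edges G, lab = h \<circ> lab G, inc = inc G, srcs = srcs G \<rparr>"

definition pos_in :: "'v list \<Rightarrow> 'v \<Rightarrow> nat" where
  "pos_in xs v = (THE i. i < length xs \<and> xs ! i = v)"

definition flatten :: "('v, 'e, ('w, 'f, 'a) hg) hg \<Rightarrow> ('v + ('e \<times> 'w), 'e \<times> 'f, 'a) hg" where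
  "flatten G = \<lparr>
     verts = Inl ` verts G \<union>
             {Inr (e, v) | e v. e \<in> edges G \<and> v \<in> verts (lab G e) \<and> v \<notin> set (srcs (lab G e))},
     edges = {(e, f). e \<in> edges G \<and> f \<in> edges (lab G e)},
     lab = (\<lambda>(e, f). lab (lab G e) f),
     inc = (\<lambda>(e, f). map (\<lambda>v. if v \<in> set (srcs (lab G e))
                                then Inl (inc G e ! pos_in (srcs (lab G e)) v)
                                else Inr (e, v))
                          (inc (lab G e) f)),
     srcs = map Inl (srcs G) \<rparr>"

definition H_algebra :: "'b set \<Rightarrow> ('b \<Rightarrow> nat) \<Rightarrow> ('b H \<Rightarrow> 'b) \<Rightarrow> bool" where
  "H_algebra A arA pi \<longleftrightarrow>
     (\<forall>G. wf_hg arA A G \<longrightarrow> pi G \<in> A \<and> arA (pi G) = hg_arity G) \<and>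
     (\<forall>G G'. wf_hg arA A G \<and> wf_hg arA A G' \<and> hg_iso G G' \<longrightarrow> pi G = pi G') \<and>
     (\<forall>a \<in> A. pi (hg_unit arA a) = a) \<and>
     (\<forall>(G :: ('b H) H) (F :: 'b H).
        wf_hg hg_arity {K. wf_hg arA A K} G \<and> wf_hg arA A F \<and> hg_iso F (flatten G)
        \<longrightarrow> pi F = pi (hg_map pi G))"

definition H_hom_free :: "('a \<Rightarrow> nat) \<Rightarrow> 'a set \<Rightarrow> 'b set \<Rightarrow> ('b \<Rightarrow> nat) \<Rightarrow> ('b H \<Rightarrow> 'b)
                          \<Rightarrow> ('a H \<Rightarrow> 'b) \<Rightarrow> bool" where
  "H_hom_free ar S A arA pi h \<longleftrightarrow>
     (\<forall>G. wf_hg ar S G \<longrightarrow> h G \<in> A \<and> arA (h G) = hg_arity G) \<and>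
     (\<forall>G G'. wf_hg ar S G \<and> wf_hg ar S G' \<and> hg_iso G G' \<longrightarrow> h G = h G') \<and>
     (\<forall>(G :: ('a H) H) (F :: 'a H).
        wf_hg hg_arity {K. wf_hg ar S K} G \<and> wf_hg ar S F \<and> hg_iso F (flatten G)
        \<longrightarrow> h F = pi (hg_map h G))"

definition H0 :: "('a \<Rightarrow> nat) \<Rightarrow> 'a set \<Rightarrow> 'a H set" where
  "H0 ar S = {G. wf_hg ar S G \<and> srcs G = []}"

definition recognised_by :: "('a \<Rightarrow> nat) \<Rightarrow> 'a set \<Rightarrow> 'a H set
                              \<Rightarrow> 'b set \<Rightarrow> ('b \<Rightarrow> nat) \<Rightarrow> ('b H \<Rightarrow> 'b) \<Rightarrow> bool" where
  "recognised_by ar S L A arA pi \<longleftrightarrow>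
     (\<exists>h F. H_hom_free ar S A arA pi h \<and> L = {G \<in> H0 ar S. h G \<in> F})"

definition finite_on_every_arity :: "'b set \<Rightarrow> ('b \<Rightarrow> nat) \<Rightarrow> bool" where
  "finite_on_every_arity A arA \<longleftrightarrow> (\<forall>n. finite {a \<in> A. arA a = n})"

datatype recf = Zf | Sf | Idf nat | Cnf recf "recf list" | Prf recf recf | Mnf recf

inductive rf_eval :: "recf \<Rightarrow> nat list \<Rightarrow> nat \<Rightarrow> bool" where
  "rf_eval Zf xs 0"
| "rf_eval Sf (x # xs) (Suc x)"
| "i < length xs \<Longrightarrow> rf_eval (Idf i) xs (xs ! i)"
| "length ys = length gs \<Longrightarrow> (\<forall>i < length gs. rf_eval (gs ! i) xs (ys ! i)) \<Longrightarrow>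
     rf_eval f ys y \<Longrightarrow> rf_eval (Cnf f gs) xs y"
| "rf_eval f xs y \<Longrightarrow> rf_eval (Prf f g) (0 # xs) y"
| "rf_eval (Prf f g) (n # xs) r \<Longrightarrow> rf_eval g (n # r # xs) y \<Longrightarrow> rf_eval (Prf f g) (Suc n # xs) y"
| "rf_eval f (n # xs) 0 \<Longrightarrow> (\<forall>m < n. \<exists>k. rf_eval f (m # xs) (Suc k)) \<Longrightarrow> rf_eval (Mnf f) xs n"

definition enc_hg :: "('b \<Rightarrow> nat) \<Rightarrow> 'b H \<Rightarrow> nat" where
  "enc_hg code G = list_encode
     [ list_encode (sorted_list_of_set (verts G)),
       list_encode (map (\<lambda>e. list_encode [e, code (lab G e), list_encode (inc G e)])
                        (sorted_list_of_set (edges G))),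
       list_encode (srcs G) ]"

text \<open>A computable H-algebra: elements are represented injectively by natural numbers
(code), there is an algorithm which on input (n, i), i >= 1, outputs Suc (code of the
i-th n-ary element) or 0 if there are fewer than i n-ary elements, and an algorithm
computing the product of (the encoding of) any element of H A.\<close>

definition computable_H_algebra :: "'b set \<Rightarrow> ('b \<Rightarrow> nat) \<Rightarrow> ('b H \<Rightarrow> 'b) \<Rightarrow> bool" where
  "computable_H_algebra A arA pi \<longleftrightarrow> H_algebra A arA pi \<and>
     (\<exists>code :: 'b \<Rightarrow> nat. inj_on code A \<and>
       (\<exists>p. \<forall>n.
          (\<forall>i \<ge> 1. \<exists>r. rf_eval p [n, i] r \<and>
                        (r = 0 \<or> (\<exists>a \<in> A. arA a = n \<and> r = Suc (code a)))) \<and>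
          (\<forall>i j r. 1 \<le> i \<longrightarrow> i \<le> j \<longrightarrow> rf_eval p [n, j] (Suc r) \<longrightarrow> \<not> rf_eval p [n, i] 0) \<and>
          (\<forall>i j r. 1 \<le> i \<longrightarrow> 1 \<le> j \<longrightarrow> rf_eval p [n, i] (Suc r) \<longrightarrow> rf_eval p [n, j] (Suc r) \<longrightarrow> i = j) \<and>
          (\<forall>a \<in> A. arA a = n \<longrightarrow> (\<exists>i \<ge> 1. rf_eval p [n, i] (Suc (code a))))) \<and>
       (\<exists>q. \<forall>G. wf_hg arA A G \<longrightarrow> rf_eval q [enc_hg code G] (code (pi G))))"

text \<open>Terms: first-order variables and source constants (1-based).\<close>

datatype trm = FV nat | Src nat

datatype 'a cmso =
    Lab 'a trm
  | Inc nat trm trm       \<comment> \<open>Inc i x y: x is a hyperedge with x[i] = y (1-based)\<close>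
  | Eq trm trm
  | Mem trm nat
  | CardMod nat nat nat   \<comment> \<open>CardMod X k m: |X| = k mod m\<close>
  | Neg "'a cmso"
  | Conj "'a cmso" "'a cmso"
  | Ex1 nat "'a cmso"
  | Ex2 nat "'a cmso"

type_synonym ('v, 'e) elt = "'v + 'e"

fun trm_val :: "('v, 'e, 'a) hg \<Rightarrow> (nat \<Rightarrow> ('v, 'e) elt) \<Rightarrow> trm \<Rightarrow> ('v, 'e) elt" where
  "trm_val G \<sigma> (FV x) = \<sigma> x"
| "trm_val G \<sigma> (Src i) = Inl (srcs G ! (i - 1))"

definition universe :: "('v, 'e, 'a) hg \<Rightarrow> ('v, 'e) elt set" where
  "universe G = Inl ` verts G \<union> Inr ` edges G"

fun sat :: "('v, 'e, 'a) hg \<Rightarrow> (nat \<Rightarrow> ('v, 'e) elt) \<Rightarrow> (nat \<Rightarrow> ('v, 'e) elt set) \<Rightarrow> 'a cmso \<Rightarrow> bool" where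
  "sat G \<sigma> \<Theta> (Lab a t) = (\<exists>e \<in> edges G. trm_val G \<sigma> t = Inr e \<and> lab G e = a)"
| "sat G \<sigma> \<Theta> (Inc i t u) = (\<exists>e \<in> edges G. trm_val G \<sigma> t = Inr e \<and> 1 \<le> i \<and> i \<le> length (inc G e)
                                 \<and> trm_val G \<sigma> u = Inl (inc G e ! (i - 1)))"
| "sat G \<sigma> \<Theta> (Eq t u) = (trm_val G \<sigma> t = trm_val G \<sigma> u)"
| "sat G \<sigma> \<Theta> (Mem t X) = (trm_val G \<sigma> t \<in> \<Theta> X)"
| "sat G \<sigma> \<Theta> (CardMod X k m) = (finite (\<Theta> X) \<and> card (\<Theta> X) mod m = k mod m)"
| "sat G \<sigma> \<Theta> (Neg \<phi>) = (\<not> sat G \<sigma> \<Theta> \<phi>)"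
| "sat G \<sigma> \<Theta> (Conj \<phi> \<psi>) = (sat G \<sigma> \<Theta> \<phi> \<and> sat G \<sigma> \<Theta> \<psi>)"
| "sat G \<sigma> \<Theta> (Ex1 x \<phi>) = (\<exists>u \<in> universe G. sat G (\<sigma>(x := u)) \<Theta> \<phi>)"
| "sat G \<sigma> \<Theta> (Ex2 X \<phi>) = (\<exists>U \<subseteq> universe G. sat G \<sigma> (\<Theta>(X := U)) \<phi>)"

fun trm_fv :: "trm \<Rightarrow> nat set" where
  "trm_fv (FV x) = {x}"
| "trm_fv (Src i) = {}"

fun fv1 :: "'a cmso \<Rightarrow> nat set" where
  "fv1 (Lab a t) = trm_fv t"
| "fv1 (Inc i t u) = trm_fv t \<union> trm_fv u"
| "fv1 (Eq t u) = trm_fv t \<union> trm_fv u"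
| "fv1 (Mem t X) = trm_fv t"
| "fv1 (CardMod X k m) = {}"
| "fv1 (Neg \<phi>) = fv1 \<phi>"
| "fv1 (Conj \<phi> \<psi>) = fv1 \<phi> \<union> fv1 \<psi>"
| "fv1 (Ex1 x \<phi>) = fv1 \<phi> - {x}"
| "fv1 (Ex2 X \<phi>) = fv1 \<phi>"

fun fv2 :: "'a cmso \<Rightarrow> nat set" where
  "fv2 (Lab a t) = {}"
| "fv2 (Inc i t u) = {}"
| "fv2 (Eq t u) = {}"
| "fv2 (Mem t X) = {X}"
| "fv2 (CardMod X k m) = {X}"
| "fv2 (Neg \<phi>) = fv2 \<phi>"
| "fv2 (Conj \<phi> \<psi>) = fv2 \<phi> \<union> fv2 \<psi>"
| "fv2 (Ex1 x \<phi>) = fv2 \<phi>"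
| "fv2 (Ex2 X \<phi>) = fv2 \<phi> - {X}"

fun trm_wf :: "nat \<Rightarrow> trm \<Rightarrow> bool" where
  "trm_wf n (FV x) = True"
| "trm_wf n (Src i) = (1 \<le> i \<and> i \<le> n)"

fun cmso_wf :: "('a \<Rightarrow> nat) \<Rightarrow> 'a set \<Rightarrow> nat \<Rightarrow> 'a cmso \<Rightarrow> bool" where
  "cmso_wf ar S n (Lab a t) = (a \<in> S \<and> trm_wf n t)"
| "cmso_wf ar S n (Inc i t u) = (1 \<le> i \<and> (\<exists>a \<in> S. i \<le> ar a) \<and> trm_wf n t \<and> trm_wf n u)"
| "cmso_wf ar S n (Eq t u) = (trm_wf n t \<and> trm_wf n u)"
| "cmso_wf ar S n (Mem t X) = trm_wf n t"
| "cmso_wf ar S n (CardMod X k m) = (0 < m)"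
| "cmso_wf ar S n (Neg \<phi>) = cmso_wf ar S n \<phi>"
| "cmso_wf ar S n (Conj \<phi> \<psi>) = (cmso_wf ar S n \<phi> \<and> cmso_wf ar S n \<psi>)"
| "cmso_wf ar S n (Ex1 x \<phi>) = cmso_wf ar S n \<phi>"
| "cmso_wf ar S n (Ex2 X \<phi>) = cmso_wf ar S n \<phi>"

definition cmso_sentence :: "('a \<Rightarrow> nat) \<Rightarrow> 'a set \<Rightarrow> nat \<Rightarrow> 'a cmso \<Rightarrow> bool" where
  "cmso_sentence ar S n \<phi> \<longleftrightarrow> cmso_wf ar S n \<phi> \<and> fv1 \<phi> = {} \<and> fv2 \<phi> = {}"

definition models :: "('v, 'e, 'a) hg \<Rightarrow> 'a cmso \<Rightarrow> bool" where
  "models G \<phi> \<longleftrightarrow> sat G (\<lambda>_. undefined) (\<lambda>_. {}) \<phi>"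

definition cmso2_definable :: "('a \<Rightarrow> nat) \<Rightarrow> 'a set \<Rightarrow> 'a H set \<Rightarrow> bool" where
  "cmso2_definable ar S L \<longleftrightarrow>
     (\<exists>\<phi>. cmso_sentence ar S 0 \<phi> \<and> L = {G \<in> H0 ar S. models G \<phi>})"

end

theory Submission
  imports Defs
begin

text \<open>Counting MSO formulas are brought into a normal form in which all variables are set variables
  and an atomic formula sums weights of vertices and hyperedges in a finite quotient of the natural
  numbers.  By induction on a normal form one gets, for every arity, a finite set of values and a
  product of hypergraphs labelled by values: for an atomic formula a value is the partial sum over
  all elements except the sources, for a conjunction it is a pair, and for an existential quantifier
  it is a set of pairs consisting of a set of sources and a value of the quantified formula.  The
  values are not required to be realised by any hypergraph.  This is essential for computability,
  because satisfiability of MSO over finite hypergraphs is undecidable.  Values are coded by natural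
  numbers, and the product is computed by a program on lists, which is translated into a recursive
  function.\<close>

section \<open>Recursive functions\<close>

text \<open>A choice made inside one component of a flattening affects the other components only
  through shared vertices, and these are sources of the component; hence source bits are all that a
  quantifier has to export. Every atomic fact can be made a sum over single elements: equality and
  membership ask for an element carrying two marks, labels and incidences for one hyperedge together
  with the colours of its own vertices. Sums split along a flattening provided that no vertex is
  counted twice, which is why a component leaves its sources to the hypergraph around it. Existence
  and uniqueness tests need small numbers exactly, while modular predicates need residues; this
  dictates the quotient. Labels from the alphabet are consulted only when letters are sent into the
  algebra, so that the product works on values alone and the formula is otherwise met only by the
  accepting set.\<close>

inductive_cases rf_eval_elims:
  "rf_eval Zf xs y" "rf_eval Sf xs y" "rf_eval (Idf i) xs y" "rf_eval (Cnf f gs) xs y"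
  "rf_eval (Prf f g) (0 # xs) y" "rf_eval (Prf f g) (Suc n # xs) y" "rf_eval (Mnf f) xs y"

text \<open>Determinism lets conditions on every outcome of a program, as in the enumeration clauses
  of a computable algebra, be read as statements about one function. For \<open>Mnf\<close>, the
  smaller of two different results would be both a zero and a non-zero of the searched
  function.\<close>

lemma rf_eval_deterministic:
  "rf_eval p xs y \<Longrightarrow> rf_eval p xs z \<Longrightarrow> y = z"
proof (induction arbitrary: z rule: rf_eval.induct)
  case (1 xs)
  then show ?case by (rule rf_eval_elims(1)) simp
next
  case (2 x xs)
  then show ?case by (rule rf_eval_elims(2)) simp
next
  case (3 i xs)
  from "3.prems" show ?case by (rule rf_eval_elims(3)) simp
next
  case (5 f xs y g)
  from "5.prems" have "rf_eval f xs z" by (rule rf_eval_elims(5))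
  then show ?case by (rule "5.IH")
next
  case (4 ys gs xs f y)
  from "4.prems" obtain zs where zs: "length zs = length gs"
      "\<forall>i < length gs. rf_eval (gs ! i) xs (zs ! i)" "rf_eval f zs z"
    by (rule rf_eval_elims(4)) blast
  have "ys = zs"
    using "4.hyps" "4.IH" zs by (intro nth_equalityI) auto
  then show ?case using "4.IH" zs by auto
next
  case (6 f g n xs r y)
  from "6.prems" obtain r' where "rf_eval (Prf f g) (n # xs) r'" "rf_eval g (n # r' # xs) z"
    by (rule rf_eval_elims(6))
  then show ?case using "6.IH" by metis
next
  case (7 f n xs)
  from "7.prems" have z: "rf_eval f (z # xs) 0" "\<forall>m < z. \<exists>k. rf_eval f (m # xs) (Suc k)"
    by (rule rf_eval_elims(7); blast)+
  show ?case
  proof (rule linorder_cases[of n z])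
    assume "n < z"
    then obtain k where "rf_eval f (n # xs) (Suc k)" using z by blast
    then show ?thesis using "7.IH"(1) by fastforce
  next
    assume "z < n"
    then show ?thesis using "7.IH"(2) z(1) by blast
  qed
qed

text \<open>Closure properties are stated for functions of the logic instead of \<open>recf\<close>
  terms; only argument lists of length \<open>k\<close> are constrained.\<close>

definition recursive :: "nat \<Rightarrow> (nat list \<Rightarrow> nat) \<Rightarrow> bool" where
  "recursive k f \<longleftrightarrow> (\<exists>p. \<forall>xs. length xs = k \<longrightarrow> rf_eval p xs (f xs))"

lemma recursive_cong:
  "recursive k f \<Longrightarrow> (\<And>xs. length xs = k \<Longrightarrow> f xs = g xs) \<Longrightarrow> recursive k g"
  unfolding recursive_def by auto

lemma recursive_nth: "i < k \<Longrightarrow> recursive k (\<lambda>xs. xs ! i)"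
  unfolding recursive_def by (rule exI[of _ "Idf i"]) (simp add: rf_eval.intros)

lemma recursive_compose:
  assumes "recursive (length gs) f" "\<forall>g \<in> set gs. recursive k g"
  shows "recursive k (\<lambda>xs. f (map (\<lambda>g. g xs) gs))"
proof -
  from assms(1) obtain p where p: "\<And>xs. length xs = length gs \<Longrightarrow> rf_eval p xs (f xs)"
    unfolding recursive_def by blast
  from assms(2) obtain q where
    q: "\<And>g xs. g \<in> set gs \<Longrightarrow> length xs = k \<Longrightarrow> rf_eval (q g) xs (g xs)"
    unfolding recursive_def by metis
  have "rf_eval (Cnf p (map q gs)) xs (f (map (\<lambda>g. g xs) gs))" if "length xs = k" for xs
    using that by (intro rf_eval.intros(4)[of "map (\<lambda>g. g xs) gs"]) (auto simp: p q)
  then show ?thesis unfolding recursive_def by blast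
qed

lemma recursive_Suc: "recursive k f \<Longrightarrow> recursive k (\<lambda>xs. Suc (f xs))"
proof -
  have "recursive 1 (\<lambda>xs. Suc (hd xs))"
    unfolding recursive_def
    by (rule exI[of _ Sf]) (auto simp: length_Suc_conv intro: rf_eval.intros)
  then show "recursive k f \<Longrightarrow> ?thesis"
    using recursive_compose[of "[f]" "\<lambda>xs. Suc (hd xs)" k] by simp
qed

lemma recursive_const: "recursive k (\<lambda>xs. n)"
proof (induction n)
  case 0
  show ?case unfolding recursive_def by (auto intro!: exI[of _ Zf] rf_eval.intros)
qed (rule recursive_Suc)

text \<open>\<open>Prf\<close> recurses on the head of its argument list and keeps the tail as
  parameters, so \<open>a xs\<close> is put in front of \<open>xs\<close> by a composition with
  projections.\<close>

lemma recursive_rec_nat: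
  assumes b: "recursive k b" and s: "recursive (Suc (Suc k)) (\<lambda>ys. s (ys ! 0) (ys ! 1) (drop 2 ys))"
    and a: "recursive k a"
  shows "recursive k (\<lambda>xs. rec_nat (b xs) (\<lambda>n r. s n r xs) (a xs))"
proof -
  obtain pb where pb: "\<And>xs. length xs = k \<Longrightarrow> rf_eval pb xs (b xs)"
    using b unfolding recursive_def by blast
  obtain ps where ps: "\<And>ys. length ys = Suc (Suc k) \<Longrightarrow>
      rf_eval ps ys (s (ys ! 0) (ys ! 1) (drop 2 ys))"
    using s unfolding recursive_def by blast
  have step: "rf_eval (Prf pb ps) (n # xs) (rec_nat (b xs) (\<lambda>n r. s n r xs) n)"
    if "length xs = k" for n xs
  proof (induction n)
    case (Suc n)
    have "rf_eval ps (n # rec_nat (b xs) (\<lambda>n r. s n r xs) n # xs)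
        (rec_nat (b xs) (\<lambda>n r. s n r xs) (Suc n))"
      using ps[of "n # rec_nat (b xs) (\<lambda>n r. s n r xs) n # xs"] that by simp
    with Suc show ?case by (rule rf_eval.intros(6))
  qed (simp add: that pb rf_eval.intros)
  define h where "h = (\<lambda>ys. rec_nat (b (tl ys)) (\<lambda>n r. s n r (tl ys)) (hd ys))"
  have "recursive (Suc k) h"
    unfolding recursive_def h_def
    by (rule exI[of _ "Prf pb ps"]) (auto simp: length_Suc_conv step)
  then have "recursive k (\<lambda>xs. h (map (\<lambda>g. g xs) (a # map (\<lambda>i xs. xs ! i) [0..<k])))"
    by (intro recursive_compose) (auto simp: a intro: recursive_nth)
  then show ?thesis
    by (rule recursive_cong) (auto simp: h_def comp_def map_nth)
qed

lemma recursive_Least: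
  assumes f: "recursive (Suc k) (\<lambda>ys. f (ys ! 0) (drop 1 ys))"
    and ex: "\<And>xs. length xs = k \<Longrightarrow> \<exists>n. f n xs = 0"
  shows "recursive k (\<lambda>xs. LEAST n. f n xs = 0)"
proof -
  obtain p where p: "\<And>ys. length ys = Suc k \<Longrightarrow> rf_eval p ys (f (ys ! 0) (drop 1 ys))"
    using f unfolding recursive_def by blast
  have p': "rf_eval p (n # xs) (f n xs)" if "length xs = k" for n xs
    using p[of "n # xs"] that by simp
  have "rf_eval (Mnf p) xs (LEAST n. f n xs = 0)" if "length xs = k" for xs
  proof (rule rf_eval.intros(7))
    have "f (LEAST n. f n xs = 0) xs = 0" using ex[OF that] by (rule LeastI_ex)
    then show "rf_eval p ((LEAST n. f n xs = 0) # xs) 0" using p'[OF that] by metis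
    show "\<forall>m < (LEAST n. f n xs = 0). \<exists>k. rf_eval p (m # xs) (Suc k)"
      using p'[OF that] not_less_Least by (metis not0_implies_Suc)
  qed
  then show ?thesis unfolding recursive_def by blast
qed

section \<open>Arithmetic and the decoding of pairs\<close>

lemma recursive_add:
  assumes "recursive k a" "recursive k b" shows "recursive k (\<lambda>xs. a xs + b xs)"
proof -
  have "recursive k (\<lambda>xs. rec_nat (a xs) (\<lambda>n r. Suc r) (b xs))"
    by (intro recursive_rec_nat recursive_Suc recursive_nth assms) simp
  moreover have "rec_nat m (\<lambda>n r. Suc r) n = m + n" for m n by (induction n) auto
  ultimately show ?thesis by simp
qed

lemma recursive_diff:
  assumes "recursive k a" "recursive k b" shows "recursive k (\<lambda>xs. a xs - b xs)"
proof -
  have "recursive k (\<lambda>xs. rec_nat (a xs) (\<lambda>n r. rec_nat 0 (\<lambda>m _. m) r) (b xs))"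
    by (intro recursive_rec_nat recursive_nth recursive_const assms) simp_all
  moreover have "rec_nat 0 (\<lambda>m _. m) r = r - 1" for r by (cases r) auto
  moreover have "rec_nat m (\<lambda>n r. r - 1) n = m - n" for m n :: nat by (induction n) auto
  ultimately show ?thesis by simp
qed

lemma recursive_triangle:
  assumes "recursive k a" shows "recursive k (\<lambda>xs. triangle (a xs))"
proof -
  have "recursive k (\<lambda>xs. rec_nat 0 (\<lambda>n r. r + Suc n) (a xs))"
    by (intro recursive_rec_nat recursive_add recursive_Suc recursive_nth recursive_const assms) simp_all
  moreover have "rec_nat 0 (\<lambda>n r. r + Suc n) n = triangle n" for n by (induction n) auto
  ultimately show ?thesis by simp
qed

lemma recursive_prod_encode:
  "recursive k a \<Longrightarrow> recursive k b \<Longrightarrow> recursive k (\<lambda>xs. prod_encode (a xs, b xs))"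
  unfolding prod_encode_def prod.case by (intro recursive_add recursive_triangle)

lemma triangle_mono: "m \<le> n \<Longrightarrow> triangle m \<le> triangle n"
  by (induction rule: dec_induct) auto

text \<open>\<open>prod_encode (i, j)\<close> is \<open>triangle (i + j) + i\<close>, so it lies on
  diagonal \<open>i + j\<close>; the vanishing truncated difference says that it is smaller than the
  first code of diagonal \<open>Suc s\<close>.\<close>

lemma Least_triangle_prod_encode:
  "(LEAST s. Suc (prod_encode (i, j)) - triangle (Suc s) = 0) = i + j"
proof (rule Least_equality)
  fix s assume *: "Suc (prod_encode (i, j)) - triangle (Suc s) = 0"
  show "i + j \<le> s"
  proof (rule ccontr)
    assume "\<not> i + j \<le> s"
    then have "triangle (Suc s) \<le> triangle (i + j)" by (intro triangle_mono) auto
    with * show False by (simp add: prod_encode_def)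
  qed
qed (simp add: prod_encode_def)

text \<open>Once minimisation has found the diagonal \<open>d x\<close>, subtracting
  \<open>triangle (d x)\<close> leaves the first component, and the second is what remains of the
  diagonal number.\<close>

lemma recursive_prod_decode:
  assumes "recursive k a"
  shows "recursive k (\<lambda>xs. fst (prod_decode (a xs)))" "recursive k (\<lambda>xs. snd (prod_decode (a xs)))"
proof -
  define d where "d = (\<lambda>x. LEAST s. Suc x - triangle (Suc s) = 0)"
  have "recursive 1 (\<lambda>xs. LEAST s. Suc (xs ! 0) - triangle (Suc s) = 0)"
  proof (rule recursive_Least)
    have "recursive (Suc 1) (\<lambda>ys. Suc (ys ! 1) - triangle (Suc (ys ! 0)))"
      by (intro recursive_diff recursive_triangle recursive_Suc recursive_nth) simp_all
    then show "recursive (Suc 1) (\<lambda>ys. Suc (drop 1 ys ! 0) - triangle (Suc (ys ! 0)))"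
      by (rule recursive_cong) simp
    show "\<exists>n. Suc (xs ! 0) - triangle (Suc n) = 0" for xs :: "nat list"
      by (rule exI[of _ "xs ! 0"]) simp
  qed
  with recursive_compose[of "[a]" "\<lambda>xs. LEAST s. Suc (xs ! 0) - triangle (Suc s) = 0" k] assms
  have d: "recursive k (\<lambda>xs. d (a xs))" by (simp add: d_def)
  have "fst (prod_decode x) = x - triangle (d x) \<and>
      snd (prod_decode x) = d x - (x - triangle (d x))" for x
  proof -
    obtain i j where x: "x = prod_encode (i, j)" by (metis prod_decode_inverse surj_pair)
    have "d x = i + j" unfolding d_def x by (rule Least_triangle_prod_encode)
    then show ?thesis by (simp add: x) (simp add: prod_encode_def)
  qed
  then show "recursive k (\<lambda>xs. fst (prod_decode (a xs)))" "recursive k (\<lambda>xs. snd (prod_decode (a xs)))"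
    by (auto intro!: recursive_diff recursive_triangle d assms)
qed

section \<open>Computable functions between encoded types\<close>

class codable =
  fixes cod :: "'a \<Rightarrow> nat"
  assumes inj_cod: "inj cod"

lemma cod_eq_iff [simp]: "cod x = cod y \<longleftrightarrow> x = y"
  using inj_cod by (auto simp: inj_def)

instantiation nat :: codable
begin
definition cod_nat :: "nat \<Rightarrow> nat" where [simp]: "cod_nat n = n"
instance by standard (simp add: inj_def)
end

instantiation bool :: codable
begin
definition cod_bool :: "bool \<Rightarrow> nat" where [simp]: "cod_bool b = of_bool b"
instance by standard (simp add: inj_def)
end

instantiation prod :: (codable, codable) codable
begin
definition cod_prod :: "'a \<times> 'b \<Rightarrow> nat" where [simp]: "cod_prod p = prod_encode (cod (fst p), cod (snd p))"
instance by standard (auto simp: inj_def)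
end

instantiation list :: (codable) codable
begin
definition cod_list :: "'a list \<Rightarrow> nat" where "cod_list xs = list_encode (map cod xs)"
instance by standard (simp add: inj_def cod_list_def list_encode_eq inj_map_eq_map[OF inj_cod])
end

lemma cod_list_simps [simp]:
  "cod [] = 0" "cod (x # xs) = Suc (prod_encode (cod x, cod xs))"
  by (simp_all add: cod_list_def)

lemma cod_nat_list [simp]: "cod (xs :: nat list) = list_encode xs"
  by (simp add: cod_list_def map_idI)

text \<open>Several arguments are passed as nested pairs, and the rules for binders carry an
  environment \<open>x\<close> through which bodies reach the enclosing parameters; thus
  \<open>computable_intros\<close> compiles a term by following its syntax.\<close>

definition computable :: "('a::codable \<Rightarrow> 'b::codable) \<Rightarrow> bool" where
  "computable f \<longleftrightarrow> (\<exists>g. recursive 1 g \<and> (\<forall>x. cod (f x) = g [cod x]))"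

named_theorems computable_intros

lemma computable_id [computable_intros]: "computable (\<lambda>x. x)"
  unfolding computable_def by (rule exI[of _ "\<lambda>xs. xs ! 0"]) (simp add: recursive_nth)

lemma computable_const [computable_intros]: "computable (\<lambda>x. c)"
  unfolding computable_def by (rule exI[of _ "\<lambda>xs. cod c"]) (simp add: recursive_const)

lemma computable_compose:
  assumes "computable f" "computable a" shows "computable (\<lambda>x. f (a x))"
proof -
  obtain g h where "recursive 1 g" "\<And>x. cod (f x) = g [cod x]" "recursive 1 h" "\<And>x. cod (a x) = h [cod x]"
    using assms unfolding computable_def by blast
  then show ?thesis
    unfolding computable_def using recursive_compose[of "[h]" g 1]
    by (intro exI[of _ "\<lambda>xs. g [h xs]"]) simp
qed

text \<open>Codes are chosen such that conversions like \<open>prod_encode\<close>,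
  \<open>list_decode\<close> or \<open>cod\<close> leave the code unchanged; this rule makes them
  free of charge.\<close>

lemma computable_recode:
  assumes "computable a" "\<And>x. cod (f x) = cod (a x)" shows "computable f"
  using assms unfolding computable_def by simp

lemma computable_Pair [computable_intros]:
  assumes "computable a" "computable b" shows "computable (\<lambda>x. (a x, b x))"
proof -
  obtain g h where "recursive 1 g" "\<And>x. cod (a x) = g [cod x]" "recursive 1 h" "\<And>x. cod (b x) = h [cod x]"
    using assms unfolding computable_def by blast
  then show ?thesis
    unfolding computable_def
    by (intro exI[of _ "\<lambda>xs. prod_encode (g xs, h xs)"]) (simp add: recursive_prod_encode)
qed

lemma computable_fst [computable_intros]:
  assumes "computable a" shows "computable (\<lambda>x. fst (a x))"
proof -
  obtain g where g: "recursive 1 g" "\<And>x. g [cod x] = cod (a x)"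
    using assms unfolding computable_def by metis
  show ?thesis
    unfolding computable_def
    by (rule exI[of _ "\<lambda>xs. fst (prod_decode (g xs))"]) (use g in \<open>auto intro: recursive_prod_decode simp del: One_nat_def\<close>)
qed

lemma computable_snd [computable_intros]:
  assumes "computable a" shows "computable (\<lambda>x. snd (a x))"
proof -
  obtain g where g: "recursive 1 g" "\<And>x. g [cod x] = cod (a x)"
    using assms unfolding computable_def by metis
  show ?thesis
    unfolding computable_def
    by (rule exI[of _ "\<lambda>xs. snd (prod_decode (g xs))"]) (use g in \<open>auto intro: recursive_prod_decode simp del: One_nat_def\<close>)
qed

text \<open>All later loops are reduced to this iteration. On codes it is primitive recursion, whose
  step receives counter, intermediate result and environment as one coded triple.\<close>

lemma computable_rec_nat [computable_intros]:
  fixes b :: "'a::codable \<Rightarrow> 'b::codable"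
  assumes "computable b" "computable (\<lambda>p. s (fst p) (fst (snd p)) (snd (snd p)))" "computable a"
  shows "computable (\<lambda>x. rec_nat (b x) (\<lambda>n r. s n r x) (a x))"
proof -
  obtain gb gs ga where gb: "recursive 1 gb" "\<And>x. cod (b x) = gb [cod x]"
    and gs: "recursive 1 gs" "\<And>p. cod (s (fst p) (fst (snd p)) (snd (snd p))) = gs [cod p]"
    and ga: "recursive 1 ga" "\<And>x. a x = ga [cod x]"
    using assms unfolding computable_def by (metis cod_nat_def)
  have s: "cod (s n r x) = gs [prod_encode (n, prod_encode (cod r, cod x))]" for n r x
    using gs(2)[of "(n, r, x)"] by simp
  have "recursive 1 (\<lambda>xs. rec_nat (gb xs) (\<lambda>n r. gs [prod_encode (n, prod_encode (r, xs ! 0))]) (ga xs))"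
  proof (rule recursive_rec_nat[OF gb(1) _ ga(1)])
    define q where "q = (\<lambda>ys :: nat list. prod_encode (ys ! 0, prod_encode (ys ! 1, ys ! 2)))"
    have "recursive (Suc (Suc 1)) (\<lambda>ys. gs (map (\<lambda>g. g ys) [q]))"
      using gs(1) unfolding q_def
      by (intro recursive_compose) (auto intro!: recursive_prod_encode recursive_nth)
    then show "recursive (Suc (Suc 1))
      (\<lambda>ys. gs [prod_encode (ys ! 0, prod_encode (ys ! 1, drop 2 ys ! 0))])"
      by (rule recursive_cong) (simp add: q_def)
  qed
  moreover have "cod (rec_nat (b x) (\<lambda>n r. s n r x) m) =
      rec_nat (gb [cod x]) (\<lambda>n r. gs [prod_encode (n, prod_encode (r, cod x))]) m" for x m
    by (induction m) (simp_all add: gb s)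
  ultimately show ?thesis
    unfolding computable_def by (intro exI conjI) (auto simp: ga)
qed

lemma computable_prod_encode [computable_intros]: "computable a \<Longrightarrow> computable (\<lambda>x. prod_encode (a x))"
  by (erule computable_recode) simp

lemma computable_prod_decode [computable_intros]: "computable a \<Longrightarrow> computable (\<lambda>x. prod_decode (a x))"
  by (erule computable_recode) simp

lemma computable_list_encode [computable_intros]: "computable a \<Longrightarrow> computable (\<lambda>x. list_encode (a x))"
  by (erule computable_recode) simp

lemma computable_list_decode [computable_intros]: "computable a \<Longrightarrow> computable (\<lambda>x. list_decode (a x))"
  by (erule computable_recode) simp

lemma computable_cod [computable_intros]: "computable a \<Longrightarrow> computable (\<lambda>x. cod (a x))"
  by (erule computable_recode) simp

lemma computable_of_bool [computable_intros]: "computable a \<Longrightarrow> computable (\<lambda>x. of_bool (a x) :: nat)"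
  by (erule computable_recode) simp

lemma computable_Suc [computable_intros]: "computable a \<Longrightarrow> computable (\<lambda>x. Suc (a x))"
  unfolding computable_def
  apply (elim exE conjE)
  subgoal for g by (rule exI[of _ "\<lambda>xs. Suc (g xs)"]) (simp add: recursive_Suc)
  done

lemma computable_add [computable_intros]:
  "computable a \<Longrightarrow> computable b \<Longrightarrow> computable (\<lambda>x. a x + b x :: nat)"
  unfolding computable_def
  apply (elim exE conjE)
  subgoal for g h by (rule exI[of _ "\<lambda>xs. g xs + h xs"]) (simp add: recursive_add)
  done

lemma computable_diff [computable_intros]:
  "computable a \<Longrightarrow> computable b \<Longrightarrow> computable (\<lambda>x. a x - b x :: nat)"
  unfolding computable_def
  apply (elim exE conjE)
  subgoal for g h by (rule exI[of _ "\<lambda>xs. g xs - h xs"]) (simp add: recursive_diff)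
  done

lemma computable_if [computable_intros]:
  assumes "computable P" "computable a" "computable b"
  shows "computable (\<lambda>x. if P x then a x else b x)"
proof -
  have "computable (\<lambda>x. rec_nat (b x) (\<lambda>_ _. a x) (of_bool (P x)))"
    by (intro computable_rec_nat computable_of_bool assms computable_compose[OF assms(2)]
        computable_snd computable_id)
  moreover have "rec_nat c (\<lambda>_ _. d) (of_bool Q) = (if Q then d else c)" for c d :: 'b and Q
    by simp
  ultimately show ?thesis by simp
qed

lemma computable_not [computable_intros]:
  assumes "computable P" shows "computable (\<lambda>x. \<not> P x)"
proof -
  have "computable (\<lambda>x. if P x then False else True)" by (intro computable_intros assms)
  moreover have "(if Q then False else True) = (\<not> Q)" for Q by simp
  ultimately show ?thesis by (simp only:)
qed

lemma computable_conj [computable_intros]: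
  assumes "computable P" "computable Q" shows "computable (\<lambda>x. P x \<and> Q x)"
proof -
  have "computable (\<lambda>x. if P x then Q x else False)" by (intro computable_intros assms)
  moreover have "(if R then S else False) = (R \<and> S)" for R S by simp
  ultimately show ?thesis by (simp only:)
qed

text \<open>Codes are injective, so equality amounts to the vanishing of both truncated differences
  of the codes.\<close>

lemma computable_eq [computable_intros]:
  fixes a b :: "'a::codable \<Rightarrow> 'b::codable"
  assumes "computable a" "computable b" shows "computable (\<lambda>x. a x = b x)"
proof -
  have "computable (\<lambda>x. rec_nat True (\<lambda>_ _. False) ((cod (a x) - cod (b x)) + (cod (b x) - cod (a x))))"
    by (intro computable_intros assms)
  moreover have "rec_nat True (\<lambda>_ _. False) n = (n = 0)" for n by (cases n) auto
  moreover have "m - n + (n - m) = 0 \<longleftrightarrow> m = n" for m n :: nat by auto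
  ultimately show ?thesis by simp
qed

lemma computable_less [computable_intros]:
  assumes "computable a" "computable b" shows "computable (\<lambda>x. a x < (b x :: nat))"
proof -
  have "computable (\<lambda>x. \<not> (b x - a x = 0))" by (intro computable_intros assms)
  then show ?thesis by (simp add: not_le)
qed

section \<open>Operations on lists\<close>

lemma computable_Cons [computable_intros]:
  assumes "computable a" "computable b" shows "computable (\<lambda>x. a x # b x)"
proof -
  have "computable (\<lambda>x. Suc (cod (a x, b x)))" by (intro computable_intros assms)
  then show ?thesis by (rule computable_recode) simp
qed

text \<open>A non-empty list has the successor of a pair code as its code, so head and tail are
  decoded from the predecessor. \<open>G\<close> acts on plain numbers because the pieces are
  available only as codes.\<close>

lemma computable_case_list [computable_intros]:
  fixes b :: "'b::codable \<Rightarrow> 'b list \<Rightarrow> 'a::codable \<Rightarrow> 'c::codable"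
  assumes "computable l" "computable a"
    and b: "computable (\<lambda>p. b (fst p) (fst (snd p)) (snd (snd p)))"
  shows "computable (\<lambda>x. case l x of [] \<Rightarrow> a x | y # ys \<Rightarrow> b y ys x)"
proof -
  obtain g where g: "recursive 1 g" "\<And>p. cod (b (fst p) (fst (snd p)) (snd (snd p))) = g [cod p]"
    using b unfolding computable_def by blast
  define G where "G = (\<lambda>n. g [n])"
  have G: "computable G"
    unfolding computable_def G_def
    by (rule exI[of _ "\<lambda>xs. g (map (\<lambda>h. h xs) [\<lambda>xs. xs ! 0])"]) (intro conjI recursive_compose; use g in \<open>auto intro: recursive_nth\<close>)
  have "computable (\<lambda>x. if cod (l x) = 0 then cod (a x) else
     G (prod_encode (fst (prod_decode (cod (l x) - 1)),
        prod_encode (snd (prod_decode (cod (l x) - 1)), cod x))))"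
    by (intro computable_intros assms computable_compose[OF G])
  then show ?thesis
  proof (rule computable_recode)
    show "cod (case l x of [] \<Rightarrow> a x | y # ys \<Rightarrow> b y ys x) = cod (if cod (l x) = 0 then cod (a x) else
     G (prod_encode (fst (prod_decode (cod (l x) - 1)),
        prod_encode (snd (prod_decode (cod (l x) - 1)), cod x))))" for x
      using g(2)[of "(hd (l x), tl (l x), x)"] by (cases "l x") (auto simp: G_def)
  qed
qed

lemma length_le_cod: "length xs \<le> cod xs"
proof (induction xs)
  case (Cons x xs)
  then show ?case using le_prod_encode_2[of "cod xs" "cod x"] by simp
qed simp

text \<open>The loop state is the remaining list with the accumulator. An exhausted list leaves the
  state fixed, so the code of the list, which bounds its length, can serve as the number of
  iterations.\<close>

lemma computable_fold [computable_intros]: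
  fixes l :: "'a::codable \<Rightarrow> 'b::codable list" and s :: "'a \<Rightarrow> 'c::codable"
  assumes f: "computable (\<lambda>p. f (fst p) (fst (snd p)) (snd (snd p)))" and "computable l" "computable s"
  shows "computable (\<lambda>x. fold (\<lambda>y r. f y r x) (l x) (s x))"
proof -
  define F where "F = (\<lambda>p. f (fst p) (fst (snd p)) (snd (snd p)))"
  define step where "step = (\<lambda>st x. case fst st of [] \<Rightarrow> st | y # ys \<Rightarrow> (ys, F (y, snd st, x)))"
  have "computable (\<lambda>x. snd (rec_nat (l x, s x) (\<lambda>n st. step st x) (cod (l x))))"
    unfolding step_def
    by (intro computable_intros assms computable_compose[OF f[folded F_def]])
  moreover have "snd (rec_nat (xs, r) (\<lambda>n st. step st x) n) = fold (\<lambda>y r. f y r x) xs r"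
    if "length xs \<le> n" for xs r n x
  proof -
    have *: "rec_nat (xs, r) (\<lambda>n st. step st x) n
        = (drop n xs, fold (\<lambda>y r. f y r x) (take n xs) r)" for n
    proof (induction n)
      case (Suc n)
      show ?case
      proof (cases "n < length xs")
        case True
        then show ?thesis using Suc
          by (simp add: step_def F_def Cons_nth_drop_Suc[symmetric] take_Suc_conv_app_nth)
      qed (use Suc in \<open>simp add: step_def\<close>)
    qed simp
    show ?thesis unfolding * using that by simp
  qed
  ultimately show ?thesis by (simp add: length_le_cod)
qed

lemma computable_rev [computable_intros]:
  assumes "computable l" shows "computable (\<lambda>x. rev (l x))"
proof -
  have "computable (\<lambda>x. fold (\<lambda>y r. y # r) (l x) [])" by (intro computable_intros assms)
  then show ?thesis by (simp add: fold_Cons_rev)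
qed

lemma computable_foldr [computable_intros]:
  assumes "computable (\<lambda>p. f (fst p) (fst (snd p)) (snd (snd p)))" "computable l" "computable s"
  shows "computable (\<lambda>x. foldr (\<lambda>y r. f y r x) (l x) (s x))"
  unfolding foldr_conv_fold by (intro computable_fold computable_rev assms)

lemma computable_map [computable_intros]:
  assumes f: "computable (\<lambda>p. f (fst p) (snd p))" and l: "computable l"
  shows "computable (\<lambda>x. map (\<lambda>y. f y x) (l x))"
proof -
  define F where "F = (\<lambda>p. f (fst p) (snd p))"
  have "computable (\<lambda>x. foldr (\<lambda>y r. F (y, x) # r) (l x) [])"
    by (intro computable_intros l computable_compose[OF f[folded F_def]])
  moreover have "foldr (\<lambda>y r. F (y, x) # r) xs [] = map (\<lambda>y. f y x) xs" for xs x
    by (induction xs) (auto simp: F_def)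
  ultimately show ?thesis by simp
qed

lemma computable_append [computable_intros]:
  assumes "computable a" "computable b" shows "computable (\<lambda>x. a x @ b x)"
proof -
  have "computable (\<lambda>x. foldr (\<lambda>y r. y # r) (a x) (b x))" by (intro computable_intros assms)
  moreover have "foldr (\<lambda>y r. y # r) xs ys = xs @ ys" for xs ys :: "'b list" by (induction xs) auto
  ultimately show ?thesis by simp
qed

lemma computable_concat [computable_intros]:
  assumes "computable a" shows "computable (\<lambda>x. concat (a x))"
proof -
  have "computable (\<lambda>x. foldr (\<lambda>y r. y @ r) (a x) [])" by (intro computable_intros assms)
  then show ?thesis by (simp add: concat_conv_foldr)
qed

lemma computable_filter [computable_intros]:
  assumes P: "computable (\<lambda>p. P (fst p) (snd p))" and l: "computable l"
  shows "computable (\<lambda>x. filter (\<lambda>y. P y x) (l x))"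
proof -
  define F where "F = (\<lambda>p. P (fst p) (snd p))"
  have "computable (\<lambda>x. concat (map (\<lambda>y. if F (y, x) then [y] else []) (l x)))"
    by (intro computable_intros l computable_compose[OF P[folded F_def]])
  moreover have "concat (map (\<lambda>y. if F (y, x) then [y] else []) xs) = filter (\<lambda>y. P y x) xs" for xs x
    by (induction xs) (auto simp: F_def)
  ultimately show ?thesis by simp
qed

lemma computable_member [computable_intros]:
  assumes "computable a" "computable l" shows "computable (\<lambda>x. a x \<in> set (l x))"
proof -
  have "computable (\<lambda>x. \<not> (filter (\<lambda>y. y = a x) (l x) = []))"
    by (intro computable_intros assms computable_compose[OF assms(1)])
  then show ?thesis by (simp add: filter_empty_conv)
qed

lemma computable_sum_list [computable_intros]:
  assumes "computable l" shows "computable (\<lambda>x. sum_list (l x) :: nat)"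
proof -
  have "computable (\<lambda>x. foldr (\<lambda>y r. y + r) (l x) 0)" by (intro computable_intros assms)
  then show ?thesis by (simp add: sum_list.eq_foldr)
qed

lemma computable_remdups [computable_intros]:
  assumes "computable l" shows "computable (\<lambda>x. remdups (l x))"
proof -
  have "computable (\<lambda>x. foldr (\<lambda>y r. if y \<in> set r then r else y # r) (l x) [])"
    by (intro computable_intros assms)
  moreover have "foldr (\<lambda>y r. if y \<in> set r then r else y # r) xs [] = remdups xs" for xs :: "'b list"
    by (induction xs) auto
  ultimately show ?thesis by simp
qed

lemma computable_upt [computable_intros]:
  assumes "computable a" shows "computable (\<lambda>x. [0..<a x])"
proof -
  have "computable (\<lambda>x. rec_nat [] (\<lambda>n r. r @ [n]) (a x))" by (intro computable_intros assms)
  moreover have "rec_nat [] (\<lambda>n r. r @ [n]) n = [0..<n]" for n by (induction n) auto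
  ultimately show ?thesis by simp
qed

lemma computable_drop [computable_intros]:
  assumes "computable a" "computable l" shows "computable (\<lambda>x. drop (a x) (l x))"
proof -
  have "computable (\<lambda>x. rec_nat (l x) (\<lambda>n r. case r of [] \<Rightarrow> [] | y # ys \<Rightarrow> ys) (a x))"
    by (intro computable_intros assms)
  moreover have "rec_nat xs (\<lambda>n r. case r of [] \<Rightarrow> [] | y # ys \<Rightarrow> ys) n = drop n xs" for n and xs :: "'b list"
    by (induction n) (simp_all add: drop_Suc drop_tl flip: tl_def)
  ultimately show ?thesis by simp
qed

lemma computable_product_lists [computable_intros]:
  assumes "computable l" shows "computable (\<lambda>x. product_lists (l x))"
proof -
  have "computable (\<lambda>x. foldr (\<lambda>ys r. concat (map (\<lambda>y. map (\<lambda>zs. y # zs) r) ys)) (l x) [[]])"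
    by (intro computable_intros assms)
  moreover have "foldr (\<lambda>ys r. concat (map (\<lambda>y. map (\<lambda>zs. y # zs) r) ys)) xs [[]] = product_lists xs"
    for xs :: "'b list list" by (induction xs) auto
  ultimately show ?thesis by simp
qed

section \<open>Binary arithmetic and membership in coded sets\<close>

lemma computable_power2 [computable_intros]:
  assumes "computable a" shows "computable (\<lambda>x. 2 ^ a x :: nat)"
proof -
  have "computable (\<lambda>x. rec_nat 1 (\<lambda>n r. r + r) (a x) :: nat)" by (intro computable_intros assms)
  moreover have "rec_nat 1 (\<lambda>n r. r + r) n = (2 ^ n :: nat)" for n by (induction n) auto
  ultimately show ?thesis by simp
qed

lemma computable_mod [computable_intros]:
  assumes "computable a" shows "computable (\<lambda>x. a x mod m :: nat)"
proof (cases "m = 0")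
  case False
  have "computable (\<lambda>x. rec_nat 0 (\<lambda>n r. if Suc r = m then 0 else Suc r) (a x) :: nat)"
    by (intro computable_intros assms)
  moreover have "rec_nat 0 (\<lambda>n r. if Suc r = m then 0 else Suc r) n = n mod m" for n
    using False by (induction n) (auto simp: mod_Suc)
  ultimately show ?thesis by simp
qed (use assms in simp)

lemma computable_div2 [computable_intros]:
  assumes "computable a" shows "computable (\<lambda>x. a x div 2 :: nat)"
proof -
  have "computable (\<lambda>x. rec_nat 0 (\<lambda>n r. if n mod 2 = 1 then Suc r else r) (a x) :: nat)"
    by (intro computable_intros assms)
  moreover have "rec_nat 0 (\<lambda>n r. if n mod 2 = 1 then Suc r else r) n = n div 2" for n :: nat
    by (induction n) (auto simp: div_Suc mod_Suc)
  ultimately show ?thesis by simp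
qed

text \<open>Membership is a bit test: halve \<open>b x\<close> as often as \<open>a x\<close> says
  and look at the parity.\<close>

lemma computable_set_decode [computable_intros]:
  assumes "computable a" "computable b" shows "computable (\<lambda>x. a x \<in> set_decode (b x))"
proof -
  have "computable (\<lambda>x. rec_nat (b x) (\<lambda>n r. r div 2) (a x) mod 2 = 1)"
    by (intro computable_intros assms)
  moreover have "rec_nat s (\<lambda>n r. r div 2) n = s div 2 ^ n" for s n :: nat
    by (induction n) (auto simp: div_mult2_eq[symmetric] mult.commute)
  ultimately show ?thesis by (simp add: set_decode_def odd_iff_mod_2_eq_one)
qed

section \<open>Normal forms and their algebra of values\<close>

text \<open>A colour is the list of the set variables that contain an element.  \<open>Cnt wv we m F\<close> adds up
  the weights of all vertices (\<open>wv\<close>, from the colour) and hyperedges (\<open>we\<close>, from the label, the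
  colour and the colours of the incident vertices) and tests the sum, reduced by \<open>red m\<close>, with \<open>F\<close>.\<close>

datatype 'a nf =
    Cnt "nat list \<Rightarrow> nat" "'a \<Rightarrow> nat list \<Rightarrow> nat list list \<Rightarrow> nat" nat "nat \<Rightarrow> bool"
  | NNeg "'a nf"
  | NConj "'a nf" "'a nf"
  | NEx nat "'a nf"

text \<open>The product evaluates \<open>wv\<close>, whence the demand that it be computable;
  \<open>we\<close> and \<open>F\<close> belong to the homomorphism and the accepting set. A
  positive \<open>m\<close> bounds the range of \<open>red m\<close> by
  \<open>2 * m\<close>.\<close>

fun nf_ok :: "'a nf \<Rightarrow> bool" where
  "nf_ok (Cnt wv we m F) = (0 < m \<and> computable wv)"
| "nf_ok (NNeg \<phi>) = nf_ok \<phi>"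
| "nf_ok (NConj \<phi> \<psi>) = (nf_ok \<phi> \<and> nf_ok \<psi>)"
| "nf_ok (NEx X \<phi>) = nf_ok \<phi>"

text \<open>\<open>red m\<close> picks representatives of a finite quotient of the monoid of natural numbers that
  remembers both the residue modulo \<open>m\<close> and the exact value of numbers below \<open>m\<close>.\<close>

definition red :: "nat \<Rightarrow> nat \<Rightarrow> nat" where
  "red m n = (if n < m then n else m + n mod m)"

lemma red_less: "0 < m \<Longrightarrow> red m n < 2 * m"
  by (auto simp: red_def)

lemma red_id: "n < 2 * m \<Longrightarrow> red m n = n"
  by (auto simp: red_def mod_if)

text \<open>A number not below \<open>m\<close> is replaced by one not below \<open>m\<close> with
  the same residue, and adding \<open>b\<close> preserves both properties.\<close>

lemma red_add_left: "red m (red m a + b) = red m (a + b)"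
proof (cases "a < m")
  case False
  then have "(m + a mod m + b) mod m = (a + b) mod m"
    by (metis add.assoc mod_add_left_eq mod_add_self1)
  then show ?thesis using False by (simp add: red_def)
qed (simp add: red_def)

lemma red_sum:
  assumes "finite E" shows "red m ((\<Sum>e\<in>E. red m (f e)) + b) = red m ((\<Sum>e\<in>E. f e) + b)"
  using assms
proof (induction E arbitrary: b rule: finite_induct)
  case (insert e E)
  have "red m ((\<Sum>e\<in>insert e E. red m (f e)) + b) = red m (red m (f e) + ((\<Sum>e\<in>E. red m (f e)) + b))"
    using insert by (simp add: add.assoc)
  also have "\<dots> = red m ((\<Sum>e\<in>E. red m (f e)) + (f e + b))"
    by (simp add: red_add_left add.left_commute)
  also have "\<dots> = red m ((\<Sum>e\<in>insert e E. f e) + b)"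
    using insert.IH[of "f e + b"] insert.hyps by (simp add: ac_simps)
  finally show ?case .
qed simp

text \<open>Lists replace sets so that colours have codes. Filtering discards the mark of an outer
  quantifier over the same variable; a repeated mark is harmless, since the weights from
  \<open>to_nf\<close> test membership only.\<close>

definition recolour :: "nat \<Rightarrow> bool \<Rightarrow> nat list \<Rightarrow> nat list" where
  "recolour X b c = (if b then X # c else filter (\<lambda>y. y \<noteq> X) c)"

lemma set_recolour: "set (recolour X b c) = (if b then insert X (set c) else set c - {X})"
  by (auto simp: recolour_def)

definition entry :: "bool list \<Rightarrow> nat \<Rightarrow> nat" where
  "entry u t = prod_encode (list_encode (map of_bool u), t)"

lemma entry_eq_iff [simp]: "entry u t = entry u' t' \<longleftrightarrow> u = u' \<and> t = t'"
  by (auto simp: entry_def list_encode_eq inj_map_eq_map inj_def)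

fun vals :: "'a nf \<Rightarrow> nat \<Rightarrow> nat set" where
  "vals (Cnt wv we m F) n = {..<2 * m}"
| "vals (NNeg \<phi>) n = vals \<phi> n"
| "vals (NConj \<phi> \<psi>) n = prod_encode ` (vals \<phi> n \<times> vals \<psi> n)"
| "vals (NEx X \<phi>) n = {s. set_decode s \<subseteq> {entry u t | u t. length u = n \<and> t \<in> vals \<phi> n}}"

lemma finite_entries:
  assumes "finite T" shows "finite {entry u t | u t. length u = n \<and> t \<in> T}"
proof -
  have "{entry u t | u t. length u = n \<and> t \<in> T} = (\<lambda>(u, t). entry u t) ` ({u. set u \<subseteq> UNIV \<and> length u = n} \<times> T)"
    by auto
  then show ?thesis using assms finite_lists_length_eq[of "UNIV :: bool set" n] by simp
qed

lemma finite_vals: "finite (vals \<phi> n)"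
proof (induction \<phi>)
  case (NEx X \<phi>)
  have "vals (NEx X \<phi>) n \<subseteq> set_encode ` Pow {entry u t | u t. length u = n \<and> t \<in> vals \<phi> n}"
  proof
    fix s assume "s \<in> vals (NEx X \<phi>) n"
    then show "s \<in> set_encode ` Pow {entry u t | u t. length u = n \<and> t \<in> vals \<phi> n}"
      by (intro image_eqI[of _ _ "set_decode s"]) auto
  qed
  then show ?case
    by (rule finite_subset) (intro finite_imageI finite_Pow_iff[THEN iffD2] finite_entries NEx.IH)
qed auto

text \<open>\<open>evalnf \<phi> G l c\<close> is the product of the hypergraph \<open>G\<close> whose hyperedges carry the values \<open>l\<close>
  and whose vertices have the colours \<open>c\<close>; the labels stored in \<open>G\<close> are ignored.  In a value for
  \<open>NEx X \<phi>\<close> every entry records which sources belong to \<open>X\<close>, so that choices made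
  for different hyperedges can be glued along common vertices.\<close>

primrec evalnf :: "'a nf \<Rightarrow> ('v, 'e, 'x) hg \<Rightarrow> ('e \<Rightarrow> nat) \<Rightarrow> ('v \<Rightarrow> nat list) \<Rightarrow> nat" where
  "evalnf (Cnt wv we m F) G l c =
     red m ((\<Sum>e\<in>edges G. l e) + (\<Sum>v\<in>verts G - set (srcs G). wv (c v)))"
| "evalnf (NNeg \<phi>) G l c = evalnf \<phi> G l c"
| "evalnf (NConj \<phi> \<psi>) G l c = prod_encode
     (evalnf \<phi> G (\<lambda>e. fst (prod_decode (l e))) c, evalnf \<psi> G (\<lambda>e. snd (prod_decode (l e))) c)"
| "evalnf (NEx X \<phi>) G l c = set_encode
     {entry (map d (srcs G)) (evalnf \<phi> G t (\<lambda>v. recolour X (d v) (c v))) | d t.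
        \<forall>e\<in>edges G. entry (map d (inc G e)) (t e) \<in> set_decode (l e)}"

definition labelling :: "'a nf \<Rightarrow> ('v, 'e, 'x) hg \<Rightarrow> ('e \<Rightarrow> nat) \<Rightarrow> bool" where
  "labelling \<phi> G l \<longleftrightarrow> (\<forall>e\<in>edges G. l e \<in> vals \<phi> (length (inc G e)))"

lemma labelling_NNeg [simp]: "labelling (NNeg \<phi>) G l \<longleftrightarrow> labelling \<phi> G l"
  by (simp add: labelling_def)

lemma labelling_NConj:
  "labelling (NConj \<phi> \<psi>) G l \<Longrightarrow> labelling \<phi> G (\<lambda>e. fst (prod_decode (l e)))"
  "labelling (NConj \<phi> \<psi>) G l \<Longrightarrow> labelling \<psi> G (\<lambda>e. snd (prod_decode (l e)))"
  by (fastforce simp: labelling_def)+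

lemma labelling_NEx:
  assumes "labelling (NEx X \<phi>) G l" "\<forall>e\<in>edges G. entry (map d (inc G e)) (t e) \<in> set_decode (l e)"
  shows "labelling \<phi> G t"
  using assms by (fastforce simp: labelling_def)

lemma evalnf_in_vals:
  "nf_ok \<phi> \<Longrightarrow> labelling \<phi> G l \<Longrightarrow> evalnf \<phi> G l c \<in> vals \<phi> (length (srcs G))"
proof (induction \<phi> arbitrary: l c)
  case (Cnt wv we m F)
  then show ?case by (simp add: red_less)
next
  case (NNeg \<phi>)
  then show ?case by simp
next
  case (NConj \<phi> \<psi>)
  then show ?case using labelling_NConj[OF NConj.prems(2)] by auto
next
  case (NEx X \<phi>)
  let ?S = "{entry (map d (srcs G)) (evalnf \<phi> G t (\<lambda>v. recolour X (d v) (c v))) | d t.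
        \<forall>e\<in>edges G. entry (map d (inc G e)) (t e) \<in> set_decode (l e)}"
  have sub: "?S \<subseteq> {entry u t | u t. length u = length (srcs G) \<and> t \<in> vals \<phi> (length (srcs G))}"
    using NEx.IH NEx.prems labelling_NEx[OF NEx.prems(2)] by fastforce
  have "finite ?S" using finite_entries[OF finite_vals] sub by (rule finite_subset[rotated])
  then have "set_decode (evalnf (NEx X \<phi>) G l c) = ?S" by simp
  then show ?case using sub by (simp del: evalnf.simps)
qed

text \<open>\<open>set_encode\<close> is faithful on finite sets only. Although \<open>d\<close> and
  \<open>t\<close> range over arbitrary functions, the entries have bit lists of fixed length and
  values in a finite set, so decoding returns the set itself.\<close>

lemma set_decode_evalnf_NEx:
  assumes "nf_ok \<phi>" "labelling (NEx X \<phi>) G l"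
  shows "set_decode (evalnf (NEx X \<phi>) G l c) =
     {entry (map d (srcs G)) (evalnf \<phi> G t (\<lambda>v. recolour X (d v) (c v))) | d t.
        \<forall>e\<in>edges G. entry (map d (inc G e)) (t e) \<in> set_decode (l e)}" (is "_ = ?S")
proof -
  have "?S \<subseteq> {entry u t | u t. length u = length (srcs G) \<and> t \<in> vals \<phi> (length (srcs G))}"
    using evalnf_in_vals[OF assms(1)] labelling_NEx[OF assms(2)] by fastforce
  then have "finite ?S" using finite_entries[OF finite_vals] by (rule finite_subset)
  then show ?thesis by simp
qed

section \<open>Isomorphism invariance, unit law and associativity of the evaluation\<close>

lemma evalnf_cong:
  "(\<And>e. e \<in> edges G \<Longrightarrow> l e = l' e) \<Longrightarrow> (\<And>v. v \<in> verts G \<Longrightarrow> c v = c' v) \<Longrightarrow>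
     evalnf \<phi> G l c = evalnf \<phi> G l' c'"
proof (induction \<phi> arbitrary: l l' c c')
  case (Cnt wv we m F)
  then have "(\<Sum>e\<in>edges G. l e) = (\<Sum>e\<in>edges G. l' e)"
    "(\<Sum>v\<in>verts G - set (srcs G). wv (c v)) = (\<Sum>v\<in>verts G - set (srcs G). wv (c' v))"
    by (auto intro!: sum.cong)
  then show ?case by simp
next
  case (NNeg \<phi>)
  then have "evalnf \<phi> G l c = evalnf \<phi> G l' c'" by blast
  then show ?case by simp
next
  case (NConj \<phi> \<psi>)
  have "evalnf \<phi> G (\<lambda>e. fst (prod_decode (l e))) c = evalnf \<phi> G (\<lambda>e. fst (prod_decode (l' e))) c'"
    by (rule NConj.IH) (simp_all add: NConj.prems)
  moreover have "evalnf \<psi> G (\<lambda>e. snd (prod_decode (l e))) c = evalnf \<psi> G (\<lambda>e. snd (prod_decode (l' e))) c'"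
    by (rule NConj.IH) (simp_all add: NConj.prems)
  ultimately show ?case by simp
next
  case (NEx X \<phi>)
  have "evalnf \<phi> G t (\<lambda>v. recolour X (d v) (c v)) = evalnf \<phi> G t (\<lambda>v. recolour X (d v) (c' v))" for d t
    by (rule NEx.IH) (simp_all add: NEx.prems)
  then show ?case using NEx.prems by simp
qed

lemma evalnf_iso:
  assumes fv: "bij_betw fv (verts G) (verts H)" and fe: "bij_betw fe (edges G) (edges H)"
    and inc: "\<And>e. e \<in> edges G \<Longrightarrow> inc H (fe e) = map fv (inc G e)"
    and srcs: "srcs H = map fv (srcs G)"
    and sub: "\<And>e. e \<in> edges G \<Longrightarrow> set (inc G e) \<subseteq> verts G" "set (srcs G) \<subseteq> verts G"
  shows "evalnf \<phi> H l c = evalnf \<phi> G (\<lambda>e. l (fe e)) (\<lambda>v. c (fv v))"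
proof (induction \<phi> arbitrary: l c)
  case (Cnt wv we m F)
  have "(\<Sum>e\<in>edges H. l e) = (\<Sum>e\<in>edges G. l (fe e))"
    using sum.reindex_bij_betw[OF fe, of l] by simp
  moreover have "bij_betw fv (verts G - set (srcs G)) (verts H - set (srcs H))"
    using fv sub(2) by (auto simp: bij_betw_def srcs inj_on_diff inj_on_image_set_diff[of fv "verts G"])
  from sum.reindex_bij_betw[OF this, of "\<lambda>v. wv (c v)"]
  have "(\<Sum>v\<in>verts H - set (srcs H). wv (c v)) = (\<Sum>v\<in>verts G - set (srcs G). wv (c (fv v)))"
    by simp
  ultimately show ?case by simp
next
  case (NEx X \<phi>)
  have "{entry (map d (srcs H)) (evalnf \<phi> H t (\<lambda>v. recolour X (d v) (c v))) | d t.
        \<forall>e\<in>edges H. entry (map d (inc H e)) (t e) \<in> set_decode (l e)} =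
     {entry (map d (srcs G)) (evalnf \<phi> G t (\<lambda>v. recolour X (d v) (c (fv v)))) | d t.
        \<forall>e\<in>edges G. entry (map d (inc G e)) (t e) \<in> set_decode (l (fe e))}" (is "?L = ?R")
  proof
    show "?L \<subseteq> ?R"
    proof clarify
      fix d t assume *: "\<forall>e\<in>edges H. entry (map d (inc H e)) (t e) \<in> set_decode (l e)"
      have "\<forall>e\<in>edges G. entry (map (\<lambda>v. d (fv v)) (inc G e)) (t (fe e)) \<in> set_decode (l (fe e))"
      proof
        fix e assume e: "e \<in> edges G"
        then have "fe e \<in> edges H" using fe by (auto simp: bij_betw_def)
        then show "entry (map (\<lambda>v. d (fv v)) (inc G e)) (t (fe e)) \<in> set_decode (l (fe e))"
          using * inc[OF e] by (fastforce simp: comp_def)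
      qed
      then show "\<exists>d' t'. entry (map d (srcs H)) (evalnf \<phi> H t (\<lambda>v. recolour X (d v) (c v))) =
            entry (map d' (srcs G)) (evalnf \<phi> G t' (\<lambda>v. recolour X (d' v) (c (fv v)))) \<and>
          (\<forall>e\<in>edges G. entry (map d' (inc G e)) (t' e) \<in> set_decode (l (fe e)))"
        by (intro exI[of _ "\<lambda>v. d (fv v)"] exI[of _ "\<lambda>e. t (fe e)"])
           (simp add: NEx.IH srcs comp_def)
    qed
    show "?R \<subseteq> ?L"
    proof clarify
      fix d t assume *: "\<forall>e\<in>edges G. entry (map d (inc G e)) (t e) \<in> set_decode (l (fe e))"
      \<comment> \<open>Choices on \<open>G\<close> are transported to \<open>H\<close> along the
        inverse bijections; only what they do at vertices and hyperedges of \<open>H\<close>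
        counts.\<close>
      define d' where "d' = (\<lambda>v. d (inv_into (verts G) fv v))"
      define t' where "t' = (\<lambda>e. t (inv_into (edges G) fe e))"
      have d': "d' (fv v) = d v" if "v \<in> verts G" for v
        using that fv by (simp add: d'_def bij_betw_def inv_into_f_f)
      have t': "t' (fe e) = t e" if "e \<in> edges G" for e
        using that fe by (simp add: t'_def bij_betw_def inv_into_f_f)
      have md: "map d' (map fv xs) = map d xs" if "set xs \<subseteq> verts G" for xs
        using that by (auto simp: d')
      have "\<forall>e\<in>edges H. entry (map d' (inc H e)) (t' e) \<in> set_decode (l e)"
      proof
        fix e' assume "e' \<in> edges H"
        then obtain e where e: "e \<in> edges G" "e' = fe e" using fe by (auto simp: bij_betw_def)
        then show "entry (map d' (inc H e')) (t' e') \<in> set_decode (l e')"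
          using * by (simp only: inc t' md sub e)
      qed
      moreover have "evalnf \<phi> H t' (\<lambda>v. recolour X (d' v) (c v)) =
          evalnf \<phi> G t (\<lambda>v. recolour X (d v) (c (fv v)))"
        unfolding NEx.IH by (rule evalnf_cong) (simp_all add: d' t')
      moreover have "map d' (srcs H) = map d (srcs G)"
        unfolding srcs using sub(2) by (rule md)
      ultimately show "\<exists>d' t'. entry (map d (srcs G)) (evalnf \<phi> G t (\<lambda>v. recolour X (d v) (c (fv v)))) =
          entry (map d' (srcs H)) (evalnf \<phi> H t' (\<lambda>v. recolour X (d' v) (c v))) \<and>
          (\<forall>e\<in>edges H. entry (map d' (inc H e)) (t' e) \<in> set_decode (l e))"
        by (intro exI[of _ d'] exI[of _ t']) simp
    qed
  qed
  then show ?case by simp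
qed simp_all

text \<open>Realises a list of demands, such as a bit list on the sources, by a function of the
  elements; distinctness excludes conflicting demands.\<close>

lemma ex_map_eq: "distinct xs \<Longrightarrow> length ys = length xs \<Longrightarrow> \<exists>f. map f xs = ys"
proof (induction xs arbitrary: ys)
  case (Cons x xs)
  then obtain y ys' where ys: "ys = y # ys'" by (cases ys) auto
  with Cons obtain f where "map f xs = ys'" by auto
  then have "map (f(x := y)) (x # xs) = ys" using Cons.prems ys by auto
  then show ?case by blast
qed simp

text \<open>All vertices are sources, so counting adds nothing to the value of the only hyperedge.
  Its incidence list is the source list, so a quantifier exports exactly the entries of that
  value.\<close>

lemma evalnf_unit:
  assumes G: "verts G = set (srcs G)" "edges G = {e}" "inc G e = srcs G" "distinct (srcs G)"
  shows "nf_ok \<phi> \<Longrightarrow> l e \<in> vals \<phi> (length (srcs G)) \<Longrightarrow> evalnf \<phi> G l c = l e"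
proof (induction \<phi> arbitrary: l c)
  case (Cnt wv we m F)
  then show ?case by (simp add: G red_id)
next
  case (NConj \<phi> \<psi>)
  then have "fst (prod_decode (l e)) \<in> vals \<phi> (length (srcs G))"
    "snd (prod_decode (l e)) \<in> vals \<psi> (length (srcs G))" by auto
  then show ?case using NConj by simp
next
  case (NEx X \<phi>)
  have sub: "set_decode (l e) \<subseteq> {entry u t | u t. length u = length (srcs G) \<and> t \<in> vals \<phi> (length (srcs G))}"
    using NEx.prems by simp
  have "{entry (map d (srcs G)) (evalnf \<phi> G t (\<lambda>v. recolour X (d v) (c v))) | d t.
        \<forall>e\<in>edges G. entry (map d (inc G e)) (t e) \<in> set_decode (l e)} = set_decode (l e)" (is "?L = _")
  proof
    show "?L \<subseteq> set_decode (l e)"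
    proof clarify
      fix d t assume "\<forall>e\<in>edges G. entry (map d (inc G e)) (t e) \<in> set_decode (l e)"
      then have *: "entry (map d (srcs G)) (t e) \<in> set_decode (l e)" by (simp add: G)
      then have "evalnf \<phi> G t (\<lambda>v. recolour X (d v) (c v)) = t e"
        using sub NEx.IH[of t] NEx.prems by fastforce
      then show "entry (map d (srcs G)) (evalnf \<phi> G t (\<lambda>v. recolour X (d v) (c v))) \<in> set_decode (l e)"
        using * by simp
    qed
    show "set_decode (l e) \<subseteq> ?L"
    proof
      fix x assume x: "x \<in> set_decode (l e)"
      then obtain u s where us: "x = entry u s" "length u = length (srcs G)" "s \<in> vals \<phi> (length (srcs G))"
        using sub by blast
      then obtain d where d: "map d (srcs G) = u" using ex_map_eq[OF G(4)] by blast
      have "evalnf \<phi> G (\<lambda>_. s) (\<lambda>v. recolour X (d v) (c v)) = s"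
        using NEx.IH[of "\<lambda>_. s"] NEx.prems us by simp
      then have "x = entry (map d (srcs G)) (evalnf \<phi> G (\<lambda>_. s) (\<lambda>v. recolour X (d v) (c v)))"
        using us d by simp
      moreover have "\<forall>e\<in>edges G. entry (map d (inc G e)) s \<in> set_decode (l e)"
        using G d us x by simp
      ultimately show "x \<in> ?L" by blast
    qed
  qed
  then show ?case by simp
qed simp_all

text \<open>The map of a component into the flattening: sources are identified with vertices of the
  hyperedge that the component replaces.\<close>

definition attach :: "('v, 'e, ('w, 'f, 'x) hg) hg \<Rightarrow> 'e \<Rightarrow> 'w \<Rightarrow> 'v + 'e \<times> 'w" where
  "attach G e w = (if w \<in> set (srcs (lab G e)) then Inl (inc G e ! pos_in (srcs (lab G e)) w) else Inr (e, w))"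

lemma pos_in_nth: "distinct xs \<Longrightarrow> i < length xs \<Longrightarrow> pos_in xs (xs ! i) = i"
  unfolding pos_in_def by (rule the_equality) (auto simp: nth_eq_iff_index_eq)

lemma flatten_simps:
  "verts (flatten G) = Inl ` verts G \<union> Inr ` (SIGMA e:edges G. verts (lab G e) - set (srcs (lab G e)))"
  "edges (flatten G) = (SIGMA e:edges G. edges (lab G e))"
  "inc (flatten G) (e, f) = map (attach G e) (inc (lab G e) f)"
  "lab (flatten G) (e, f) = lab (lab G e) f"
  "srcs (flatten G) = map Inl (srcs G)"
  by (auto simp: flatten_def attach_def[abs_def])

lemma attach_srcs:
  assumes "distinct (srcs (lab G e))" "length (inc G e) = length (srcs (lab G e))"
    and "i < length (inc G e)"
  shows "attach G e (srcs (lab G e) ! i) = Inl (inc G e ! i)"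
  using assms by (simp add: attach_def pos_in_nth)

lemma map_attach_srcs:
  assumes "distinct (srcs (lab G e))" "length (inc G e) = length (srcs (lab G e))"
  shows "map (attach G e) (srcs (lab G e)) = map Inl (inc G e)"
  using attach_srcs[OF assms] assms(2) by (intro nth_equalityI) auto

text \<open>This is associativity. A counting value omits the sources of its component, so every
  vertex of the flattening that is not a source is counted once. For a quantifier, a choice on the
  flattening restricts to each component along \<open>attach\<close>; conversely, choices on the
  components agree at shared vertices, because entries record the source bits, and can therefore be
  glued.\<close>

lemma evalnf_flatten:
  fixes G :: "('v, 'e, ('w, 'f, 'x) hg) hg"
  assumes fin: "finite (verts G)" "finite (edges G)"
    and lab: "\<And>e. e \<in> edges G \<Longrightarrow> finite (verts (lab G e)) \<and> finite (edges (lab G e)) \<and>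
        distinct (srcs (lab G e)) \<and> length (inc G e) = length (srcs (lab G e)) \<and>
        (\<forall>f\<in>edges (lab G e). set (inc (lab G e) f) \<subseteq> verts (lab G e))"
  shows "nf_ok \<phi> \<Longrightarrow> labelling \<phi> (flatten G) l \<Longrightarrow> evalnf \<phi> (flatten G) l c =
    evalnf \<phi> G (\<lambda>e. evalnf \<phi> (lab G e) (\<lambda>f. l (e, f)) (\<lambda>w. c (attach G e w))) (\<lambda>v. c (Inl v))"
proof (induction \<phi> arbitrary: l c)
  case (Cnt wv we m F)
  let ?N = "\<lambda>e. verts (lab G e) - set (srcs (lab G e))"
  have 1: "(\<Sum>p\<in>edges (flatten G). l p) = (\<Sum>e\<in>edges G. \<Sum>f\<in>edges (lab G e). l (e, f))"
    using fin lab by (simp add: flatten_simps sum.Sigma)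
  have "verts (flatten G) - set (srcs (flatten G)) =
      Inl ` (verts G - set (srcs G)) \<union> Inr ` (SIGMA e:edges G. ?N e)"
    by (auto simp: flatten_simps)
  moreover have "sum h (Inl ` (verts G - set (srcs G)) \<union> Inr ` (SIGMA e:edges G. ?N e)) =
      sum h (Inl ` (verts G - set (srcs G))) + sum h (Inr ` (SIGMA e:edges G. ?N e))"
    for h :: "'v + 'e \<times> 'w \<Rightarrow> nat"
    using fin lab by (intro sum.union_disjoint) auto
  ultimately have 2: "(\<Sum>v\<in>verts (flatten G) - set (srcs (flatten G)). wv (c v)) =
      (\<Sum>v\<in>verts G - set (srcs G). wv (c (Inl v))) + (\<Sum>e\<in>edges G. \<Sum>w\<in>?N e. wv (c (Inr (e, w))))"
    using fin lab by (simp add: sum.reindex sum.Sigma comp_def split_def)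
  have 3: "(\<Sum>w\<in>?N e. wv (c (attach G e w))) = (\<Sum>w\<in>?N e. wv (c (Inr (e, w))))" for e
    by (rule sum.cong) (auto simp: attach_def)
  show ?case
    unfolding evalnf.simps 1 2 3 red_sum[OF fin(2)] by (simp add: sum.distrib ac_simps)
next
  case (NNeg \<phi>)
  then show ?case by simp
next
  case (NConj \<phi> \<psi>)
  then show ?case using labelling_NConj[OF NConj.prems(2)] by simp
next
  case (NEx X \<phi>)
  let ?l = "\<lambda>e f. l (e, f)" and ?c = "\<lambda>e w. c (attach G e w)"
  have ok: "nf_ok \<phi>" using NEx.prems by simp
  have labe: "labelling (NEx X \<phi>) (lab G e) (?l e)" if "e \<in> edges G" for e
    using NEx.prems that by (auto simp: labelling_def flatten_simps)
  note dec = set_decode_evalnf_NEx[OF ok labe]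
  let ?val = "\<lambda>e. evalnf (NEx X \<phi>) (lab G e) (?l e) (?c e)"
  have "{entry (map d (srcs (flatten G))) (evalnf \<phi> (flatten G) t (\<lambda>v. recolour X (d v) (c v))) | d t.
        \<forall>e\<in>edges (flatten G). entry (map d (inc (flatten G) e)) (t e) \<in> set_decode (l e)} =
     {entry (map d (srcs G)) (evalnf \<phi> G t (\<lambda>v. recolour X (d v) (c (Inl v)))) | d t.
        \<forall>e\<in>edges G. entry (map d (inc G e)) (t e) \<in> set_decode (?val e)}" (is "?L = ?R")
  proof
    show "?L \<subseteq> ?R"
    proof clarify
      fix d t assume *: "\<forall>e\<in>edges (flatten G). entry (map d (inc (flatten G) e)) (t e) \<in> set_decode (l e)"
      \<comment> \<open>\<open>s e\<close> is the value that component \<open>e\<close> produces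
        under the restricted choice.\<close>
      define s where "s = (\<lambda>e. evalnf \<phi> (lab G e) (\<lambda>f. t (e, f))
          (\<lambda>w. recolour X (d (attach G e w)) (?c e w)))"
      have "evalnf \<phi> (flatten G) t (\<lambda>v. recolour X (d v) (c v)) =
          evalnf \<phi> G s (\<lambda>v. recolour X (d (Inl v)) (c (Inl v)))"
        unfolding s_def using NEx.IH[OF ok labelling_NEx[OF NEx.prems(2) *]] .
      moreover have "\<forall>e\<in>edges G. entry (map (\<lambda>v. d (Inl v)) (inc G e)) (s e) \<in> set_decode (?val e)"
      proof
        fix e assume e: "e \<in> edges G"
        have "map (\<lambda>w. d (attach G e w)) (srcs (lab G e)) = map (\<lambda>v. d (Inl v)) (inc G e)"
          using arg_cong[OF map_attach_srcs[of G e], of "map d"] lab[OF e] by (simp add: comp_def)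
        moreover have "\<forall>f\<in>edges (lab G e). entry (map (\<lambda>w. d (attach G e w)) (inc (lab G e) f)) (t (e, f))
            \<in> set_decode (l (e, f))"
        proof
          fix f assume "f \<in> edges (lab G e)"
          with e have "(e, f) \<in> edges (flatten G)" by (simp add: flatten_simps)
          from bspec[OF * this] show "entry (map (\<lambda>w. d (attach G e w)) (inc (lab G e) f)) (t (e, f))
            \<in> set_decode (l (e, f))" by (simp add: flatten_simps comp_def)
        qed
        ultimately show "entry (map (\<lambda>v. d (Inl v)) (inc G e)) (s e) \<in> set_decode (?val e)"
          unfolding dec[OF e] mem_Collect_eq
          by (intro exI[of _ "\<lambda>w. d (attach G e w)"] exI[of _ "\<lambda>f. t (e, f)"]) (simp add: s_def)
      qed
      ultimately show "\<exists>d' t'. entry (map d (srcs (flatten G))) (evalnf \<phi> (flatten G) t (\<lambda>v. recolour X (d v) (c v))) =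
            entry (map d' (srcs G)) (evalnf \<phi> G t' (\<lambda>v. recolour X (d' v) (c (Inl v)))) \<and>
          (\<forall>e\<in>edges G. entry (map d' (inc G e)) (t' e) \<in> set_decode (?val e))"
        by (intro exI[of _ "\<lambda>v. d (Inl v)"] exI[of _ s]) (simp add: flatten_simps comp_def)
    qed
    show "?R \<subseteq> ?L"
    proof clarify
      fix d' s assume *: "\<forall>e\<in>edges G. entry (map d' (inc G e)) (s e) \<in> set_decode (?val e)"
      define P where "P = (\<lambda>e d t. entry (map d' (inc G e)) (s e) =
            entry (map d (srcs (lab G e))) (evalnf \<phi> (lab G e) t (\<lambda>w. recolour X (d w) (?c e w))) \<and>
          (\<forall>f\<in>edges (lab G e). entry (map d (inc (lab G e) f)) (t f) \<in> set_decode (l (e, f))))"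
      have "\<exists>d t. P e d t" if "e \<in> edges G" for e
        using bspec[OF * that] unfolding dec[OF that] P_def by blast
      then obtain D T where "\<And>e. e \<in> edges G \<Longrightarrow> P e (D e) (T e)" by metis
      then have DT: "\<And>e. e \<in> edges G \<Longrightarrow> entry (map d' (inc G e)) (s e) =
            entry (map (D e) (srcs (lab G e))) (evalnf \<phi> (lab G e) (T e) (\<lambda>w. recolour X (D e w) (?c e w))) \<and>
          (\<forall>f\<in>edges (lab G e). entry (map (D e) (inc (lab G e) f)) (T e f) \<in> set_decode (l (e, f)))"
        unfolding P_def .
      \<comment> \<open>Gluing: vertices of \<open>G\<close> take their mark from \<open>d'\<close>,
        the remaining ones from the component in which they lie.\<close>
      define d where "d = case_sum d' (\<lambda>(e, w). D e w)"
      define t where "t = (\<lambda>(e, f). T e f)"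
      have d: "d (attach G e w) = D e w" if e: "e \<in> edges G" for e w
      proof (cases "w \<in> set (srcs (lab G e))")
        case True
        then obtain i where i: "i < length (srcs (lab G e))" "w = srcs (lab G e) ! i"
          by (auto simp: in_set_conv_nth)
        \<comment> \<open>Equal entries have equal bit lists, so \<open>D e\<close> agrees with
          \<open>d'\<close> at the sources of the component.\<close>
        have eq: "map d' (inc G e) = map (D e) (srcs (lab G e))" using DT[OF e] by simp
        then have "d' (inc G e ! i) = D e w" using i lab[OF e] by (metis nth_map)
        then show ?thesis using attach_srcs[of G e i] lab[OF e] i by (simp add: d_def)
      qed (simp add: attach_def d_def)
      have cond: "\<forall>p\<in>edges (flatten G). entry (map d (inc (flatten G) p)) (t p) \<in> set_decode (l p)"
        using DT by (auto simp: flatten_simps t_def comp_def d)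
      have "evalnf \<phi> (flatten G) t (\<lambda>v. recolour X (d v) (c v)) =
        evalnf \<phi> G (\<lambda>e. evalnf \<phi> (lab G e) (\<lambda>f. t (e, f)) (\<lambda>w. recolour X (d (attach G e w)) (?c e w)))
            (\<lambda>v. recolour X (d (Inl v)) (c (Inl v)))"
        by (rule NEx.IH[OF ok labelling_NEx[OF NEx.prems(2) cond]])
      also have "\<dots> = evalnf \<phi> G s (\<lambda>v. recolour X (d' v) (c (Inl v)))"
        using DT by (intro evalnf_cong) (simp_all add: d t_def, simp add: d_def)
      finally have "evalnf \<phi> (flatten G) t (\<lambda>v. recolour X (d v) (c v)) =
          evalnf \<phi> G s (\<lambda>v. recolour X (d' v) (c (Inl v)))" .
      moreover have "map d (srcs (flatten G)) = map d' (srcs G)" by (simp add: flatten_simps d_def)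
      ultimately show "\<exists>d t. entry (map d' (srcs G)) (evalnf \<phi> G s (\<lambda>v. recolour X (d' v) (c (Inl v)))) =
          entry (map d (srcs (flatten G))) (evalnf \<phi> (flatten G) t (\<lambda>v. recolour X (d v) (c v))) \<and>
          (\<forall>e\<in>edges (flatten G). entry (map d (inc (flatten G) e)) (t e) \<in> set_decode (l e))"
        using cond by (intro exI[of _ d] exI[of _ t]) simp
    qed
  qed
  then show ?case unfolding evalnf.simps(4) by simp
qed

section \<open>Satisfaction of normal forms\<close>

text \<open>\<open>U\<close> ranges over all sets of the type; as long as incidence lists stay
  inside \<open>verts G\<close>, members outside the universe influence no sum.\<close>

primrec nfsat :: "('v, 'e, 'a) hg \<Rightarrow> (('v, 'e) elt \<Rightarrow> nat list) \<Rightarrow> 'a nf \<Rightarrow> bool" where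
  "nfsat G \<chi> (Cnt wv we m F) = F (red m ((\<Sum>v\<in>verts G. wv (\<chi> (Inl v))) +
     (\<Sum>e\<in>edges G. we (lab G e) (\<chi> (Inr e)) (map (\<lambda>v. \<chi> (Inl v)) (inc G e)))))"
| "nfsat G \<chi> (NNeg \<phi>) = (\<not> nfsat G \<chi> \<phi>)"
| "nfsat G \<chi> (NConj \<phi> \<psi>) = (nfsat G \<chi> \<phi> \<and> nfsat G \<chi> \<psi>)"
| "nfsat G \<chi> (NEx X \<phi>) = (\<exists>U. nfsat G (\<lambda>u. recolour X (u \<in> U) (\<chi> u)) \<phi>)"

text \<open>An entry is judged by its value component; at arity 0, where acceptance is used, its bit
  list is empty.\<close>

primrec accepts :: "'a nf \<Rightarrow> nat \<Rightarrow> bool" where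
  "accepts (Cnt wv we m F) s = F s"
| "accepts (NNeg \<phi>) s = (\<not> accepts \<phi> s)"
| "accepts (NConj \<phi> \<psi>) s = (accepts \<phi> (fst (prod_decode s)) \<and> accepts \<psi> (snd (prod_decode s)))"
| "accepts (NEx X \<phi>) s = (\<exists>x\<in>set_decode s. accepts \<phi> (snd (prod_decode x)))"

text \<open>The value of a single hyperedge labelled \<open>a\<close> of colour \<open>b\<close> whose vertices, all of them
  sources, have the colours \<open>cs\<close>.\<close>

primrec letter :: "'a nf \<Rightarrow> 'a \<Rightarrow> nat list \<Rightarrow> nat list list \<Rightarrow> nat" where
  "letter (Cnt wv we m F) a b cs = red m (we a b cs)"
| "letter (NNeg \<phi>) a b cs = letter \<phi> a b cs"
| "letter (NConj \<phi> \<psi>) a b cs = prod_encode (letter \<phi> a b cs, letter \<psi> a b cs)"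
| "letter (NEx X \<phi>) a b cs = set_encode
     {entry u (letter \<phi> a (recolour X s b) (map2 (recolour X) u cs)) | u s. length u = length cs}"

lemma set_decode_letter_NEx:
  "set_decode (letter (NEx X \<phi>) a b cs) =
     {entry u (letter \<phi> a (recolour X s b) (map2 (recolour X) u cs)) | u s. length u = length cs}" (is "_ = ?S")
proof -
  have "?S = (\<lambda>(u, s). entry u (letter \<phi> a (recolour X s b) (map2 (recolour X) u cs))) `
      ({u. set u \<subseteq> UNIV \<and> length u = length cs} \<times> UNIV)"
    by auto
  then have "finite ?S"
    using finite_lists_length_eq[of "UNIV :: bool set" "length cs"] by simp
  then show ?thesis by simp
qed

lemma letter_in_vals: "nf_ok \<phi> \<Longrightarrow> letter \<phi> a b cs \<in> vals \<phi> (length cs)"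
proof (induction \<phi> arbitrary: b cs)
  case (Cnt wv we m F)
  then show ?case by (simp add: red_less)
next
  case (NEx X \<phi>)
  have "letter \<phi> a (recolour X s b) (map2 (recolour X) u cs) \<in> vals \<phi> (length cs)"
    if "length u = length cs" for u s
    using NEx.IH[of _ "map2 (recolour X) u cs"] NEx.prems that by simp
  then show ?case by (auto simp: set_decode_letter_NEx simp del: letter.simps)
qed auto

lemma bex_entries:
  "(\<exists>x\<in>{entry (u d) (v d t) | d t. Q d t}. R (snd (prod_decode x))) \<longleftrightarrow> (\<exists>d t. Q d t \<and> R (v d t))"
proof -
  have snd_entry: "snd (prod_decode (entry a b)) = b" for a b by (simp add: entry_def)
  show ?thesis
  proof
    assume "\<exists>d t. Q d t \<and> R (v d t)"
    then obtain d t where "Q d t" "R (v d t)" by blast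
    then show "\<exists>x\<in>{entry (u d) (v d t) | d t. Q d t}. R (snd (prod_decode x))"
      by (intro bexI[of _ "entry (u d) (v d t)"]) (auto simp: snd_entry)
  next
    assume "\<exists>x\<in>{entry (u d) (v d t) | d t. Q d t}. R (snd (prod_decode x))"
    then obtain d t where "Q d t" "R (snd (prod_decode (entry (u d) (v d t))))" by blast
    then show "\<exists>d t. Q d t \<and> R (v d t)" unfolding snd_entry by blast
  qed
qed

text \<open>A hypergraph of arity 0 is viewed as a product of letters. A set \<open>U\<close> splits
  into marks of vertices and marks of hyperedges: the former are shared and synchronised by the bit
  lists, the latter are private to a letter and already quantified inside
  \<open>letter\<close>.\<close>

lemma nfsat_iff_accepts:
  assumes "finite (edges G)" "srcs G = []"
  shows "nf_ok \<phi> \<Longrightarrow> nfsat G \<chi> \<phi> \<longleftrightarrow> accepts \<phi> (evalnf \<phi> G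
     (\<lambda>e. letter \<phi> (lab G e) (\<chi> (Inr e)) (map (\<lambda>v. \<chi> (Inl v)) (inc G e))) (\<lambda>v. \<chi> (Inl v)))"
proof (induction \<phi> arbitrary: \<chi>)
  case (Cnt wv we m F)
  then show ?case using assms by (simp add: red_sum) (simp add: add.commute)
next
  case (NEx X \<phi>)
  let ?l = "\<lambda>e. letter (NEx X \<phi>) (lab G e) (\<chi> (Inr e)) (map (\<lambda>v. \<chi> (Inl v)) (inc G e))"
  have ok: "nf_ok \<phi>" using NEx.prems by simp
  have labl: "labelling (NEx X \<phi>) G ?l"
    unfolding labelling_def using letter_in_vals[OF NEx.prems] by (metis length_map)
  \<comment> \<open>A letter has entries for all bit lists on its incident vertices, so membership
    leaves only the mark \<open>s\<close> of the hyperedge itself to be chosen.\<close>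
  have mem: "entry (map d (inc G e)) t \<in> set_decode (?l e) \<longleftrightarrow>
      (\<exists>s. t = letter \<phi> (lab G e) (recolour X s (\<chi> (Inr e))) (map (\<lambda>v. recolour X (d v) (\<chi> (Inl v))) (inc G e)))"
    for d t e
  proof -
    have "map2 (recolour X) (map d xs) (map (\<lambda>v. \<chi> (Inl v)) xs) = map (\<lambda>v. recolour X (d v) (\<chi> (Inl v))) xs" for xs
      by (induction xs) auto
    then show ?thesis unfolding set_decode_letter_NEx by auto
  qed
  have "accepts (NEx X \<phi>) (evalnf (NEx X \<phi>) G ?l (\<lambda>v. \<chi> (Inl v))) \<longleftrightarrow>
     (\<exists>d t. (\<forall>e\<in>edges G. entry (map d (inc G e)) (t e) \<in> set_decode (?l e)) \<and>
        accepts \<phi> (evalnf \<phi> G t (\<lambda>v. recolour X (d v) (\<chi> (Inl v)))))"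
    unfolding accepts.simps set_decode_evalnf_NEx[OF ok labl] by (rule bex_entries)
  also have "\<dots> \<longleftrightarrow> (\<exists>d s. accepts \<phi> (evalnf \<phi> G
        (\<lambda>e. letter \<phi> (lab G e) (recolour X (s e) (\<chi> (Inr e))) (map (\<lambda>v. recolour X (d v) (\<chi> (Inl v))) (inc G e)))
        (\<lambda>v. recolour X (d v) (\<chi> (Inl v)))))" (is "?L \<longleftrightarrow> (\<exists>d s. ?A d s)")
  proof
    assume ?L
    then obtain d t where t: "\<forall>e\<in>edges G. entry (map d (inc G e)) (t e) \<in> set_decode (?l e)"
      and acc: "accepts \<phi> (evalnf \<phi> G t (\<lambda>v. recolour X (d v) (\<chi> (Inl v))))" by blast
    from bchoice[OF t[unfolded mem]] obtain s where s: "\<forall>e\<in>edges G. t e = letter \<phi> (lab G e) (recolour X (s e) (\<chi> (Inr e)))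
        (map (\<lambda>v. recolour X (d v) (\<chi> (Inl v))) (inc G e))"
      by blast
    then have "?A d s" using acc by (subst evalnf_cong[where l' = t]) auto
    then show "\<exists>d s. ?A d s" by blast
  next
    assume "\<exists>d s. ?A d s"
    then obtain d s where "?A d s" by blast
    then show ?L
      unfolding mem
      by (intro exI[of _ d] exI[of _ "\<lambda>e. letter \<phi> (lab G e) (recolour X (s e) (\<chi> (Inr e)))
        (map (\<lambda>v. recolour X (d v) (\<chi> (Inl v))) (inc G e))"] conjI) auto
  qed
  also have "\<dots> \<longleftrightarrow> (\<exists>U. nfsat G (\<lambda>u. recolour X (u \<in> U) (\<chi> u)) \<phi>)"
  proof
    assume "\<exists>d s. ?A d s"
    then obtain d s where "?A d s" by blast
    then have "nfsat G (\<lambda>u. recolour X (u \<in> Inl ` {v. d v} \<union> Inr ` {e. s e}) (\<chi> u)) \<phi>"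
      unfolding NEx.IH[OF ok] by (simp add: image_iff)
    then show "\<exists>U. nfsat G (\<lambda>u. recolour X (u \<in> U) (\<chi> u)) \<phi>" by blast
  next
    assume "\<exists>U. nfsat G (\<lambda>u. recolour X (u \<in> U) (\<chi> u)) \<phi>"
    then obtain U where "nfsat G (\<lambda>u. recolour X (u \<in> U) (\<chi> u)) \<phi>" by blast
    then have "?A (\<lambda>v. Inl v \<in> U) (\<lambda>e. Inr e \<in> U)" unfolding NEx.IH[OF ok] .
    then show "\<exists>d s. ?A d s" by (intro exI[of _ "\<lambda>v. Inl v \<in> U"] exI[of _ "\<lambda>e. Inr e \<in> U"])
  qed
  finally show ?case by simp
qed simp_all

section \<open>From counting MSO to normal forms\<close>

text \<open>The first-order variable \<open>x\<close> becomes the set variable \<open>2 * x\<close>, constrained to be a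
  singleton, and the set variable \<open>X\<close> becomes \<open>2 * X + 1\<close>.  Source constants do not occur in
  formulas for arity 0, so their value under \<open>trm_var\<close> is irrelevant.\<close>

fun trm_var :: "trm \<Rightarrow> nat" where
  "trm_var (FV x) = 2 * x"
| "trm_var (Src i) = 0"

definition count_nf :: "(nat list \<Rightarrow> bool) \<Rightarrow> nat \<Rightarrow> (nat \<Rightarrow> bool) \<Rightarrow> 'a nf" where
  "count_nf P m F = Cnt (\<lambda>c. of_bool (P c)) (\<lambda>a c cs. of_bool (P c)) m F"

definition edge_nf :: "('a \<Rightarrow> nat list \<Rightarrow> nat list list \<Rightarrow> bool) \<Rightarrow> 'a nf" where
  "edge_nf P = Cnt (\<lambda>c. 0) (\<lambda>a c cs. of_bool (P a c cs)) 1 (\<lambda>n. 0 < n)"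

text \<open>Modulus 1 suffices for existence, since \<open>red 1\<close> separates zero from
  positive numbers. Modulus 2 isolates the number one, by which \<open>Ex1\<close> enforces a
  singleton. For \<open>CardMod\<close> the quotient preserves the residue.\<close>

fun to_nf :: "'a cmso \<Rightarrow> 'a nf" where
  "to_nf (Lab a t) = edge_nf (\<lambda>b c cs. b = a \<and> trm_var t \<in> set c)"
| "to_nf (Inc i t u) = edge_nf (\<lambda>b c cs. 1 \<le> i \<and> i \<le> length cs \<and> trm_var t \<in> set c \<and>
     trm_var u \<in> set (cs ! (i - 1)))"
| "to_nf (Eq t u) = count_nf (\<lambda>c. trm_var t \<in> set c \<and> trm_var u \<in> set c) 1 (\<lambda>n. 0 < n)"
| "to_nf (Mem t X) = count_nf (\<lambda>c. trm_var t \<in> set c \<and> 2 * X + 1 \<in> set c) 1 (\<lambda>n. 0 < n)"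
| "to_nf (CardMod X k m) = count_nf (\<lambda>c. 2 * X + 1 \<in> set c) m (\<lambda>n. n mod m = k mod m)"
| "to_nf (Neg \<phi>) = NNeg (to_nf \<phi>)"
| "to_nf (Conj \<phi> \<psi>) = NConj (to_nf \<phi>) (to_nf \<psi>)"
| "to_nf (Ex1 x \<phi>) = NEx (2 * x) (NConj (count_nf (\<lambda>c. 2 * x \<in> set c) 2 (\<lambda>n. n = 1)) (to_nf \<phi>))"
| "to_nf (Ex2 X \<phi>) = NEx (2 * X + 1) (to_nf \<phi>)"

lemma nf_ok_count_nf: "0 < m \<Longrightarrow> computable P \<Longrightarrow> nf_ok (count_nf P m F)"
  by (simp add: count_nf_def computable_of_bool)

lemma nf_ok_edge_nf: "nf_ok (edge_nf P)"
  by (simp add: edge_nf_def computable_const)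

lemma nf_ok_to_nf: "cmso_wf ar S n \<phi> \<Longrightarrow> nf_ok (to_nf \<phi>)"
  by (induction \<phi>)
    (simp_all add: nf_ok_count_nf nf_ok_edge_nf computable_conj computable_member computable_const computable_id)

lemma red_1_pos: "0 < red 1 n \<longleftrightarrow> 0 < n"
  by (simp add: red_def)

lemma red_2_eq_1: "red 2 n = 1 \<longleftrightarrow> n = 1"
  by (auto simp: red_def)

lemma red_mod: "red m n mod m = n mod m"
  by (simp add: red_def)

lemma nfsat_count_nf:
  assumes "finite (verts G)" "finite (edges G)"
  shows "nfsat G \<chi> (count_nf P m F) \<longleftrightarrow> F (red m (card {u \<in> universe G. P (\<chi> u)}))"
proof -
  have "(\<Sum>v\<in>verts G. of_bool (P (\<chi> (Inl v)))) + (\<Sum>e\<in>edges G. of_bool (P (\<chi> (Inr e)))) =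
      (\<Sum>u\<in>universe G. of_bool (P (\<chi> u)) :: nat)"
    unfolding universe_def using assms
    by (subst sum.union_disjoint) (auto simp: sum.reindex comp_def simp del: sum_of_bool_eq)
  also have "\<dots> = card {u \<in> universe G. P (\<chi> u)}"
    using assms by (simp add: sum_of_bool_eq universe_def Int_def)
  finally show ?thesis by (simp add: count_nf_def)
qed

lemma nfsat_ex_nf:
  assumes "finite (verts G)" "finite (edges G)"
  shows "nfsat G \<chi> (count_nf P 1 (\<lambda>n. 0 < n)) \<longleftrightarrow> (\<exists>u\<in>universe G. P (\<chi> u))"
proof -
  have "finite {u \<in> universe G. P (\<chi> u)}" using assms by (simp add: universe_def)
  then show ?thesis unfolding nfsat_count_nf[OF assms] red_1_pos by (auto simp: card_gt_0_iff)
qed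

lemma nfsat_edge_nf:
  assumes "finite (edges G)"
  shows "nfsat G \<chi> (edge_nf P) \<longleftrightarrow>
    (\<exists>e\<in>edges G. P (lab G e) (\<chi> (Inr e)) (map (\<lambda>v. \<chi> (Inl v)) (inc G e)))"
  unfolding edge_nf_def nfsat.simps red_1_pos using assms by (auto simp: zero_less_iff_neq_zero)

text \<open>Bound variables are unconstrained until their quantifier recolours them; in particular
  the empty colouring suits every sentence.\<close>

definition compatible :: "('v, 'e, 'a) hg \<Rightarrow> 'a cmso \<Rightarrow> (nat \<Rightarrow> ('v, 'e) elt) \<Rightarrow> (nat \<Rightarrow> ('v, 'e) elt set)
    \<Rightarrow> (('v, 'e) elt \<Rightarrow> nat list) \<Rightarrow> bool" where
  "compatible G \<phi> \<sigma> \<Theta> \<chi> \<longleftrightarrow>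
     (\<forall>x\<in>fv1 \<phi>. \<sigma> x \<in> universe G \<and> (\<forall>u\<in>universe G. 2 * x \<in> set (\<chi> u) \<longleftrightarrow> u = \<sigma> x)) \<and>
     (\<forall>X\<in>fv2 \<phi>. \<Theta> X \<subseteq> universe G \<and> (\<forall>u\<in>universe G. 2 * X + 1 \<in> set (\<chi> u) \<longleftrightarrow> u \<in> \<Theta> X))"

lemma compatible_fv1:
  assumes "compatible G \<phi> \<sigma> \<Theta> \<chi>" "x \<in> fv1 \<phi>"
  shows "\<sigma> x \<in> universe G" "u \<in> universe G \<Longrightarrow> 2 * x \<in> set (\<chi> u) \<longleftrightarrow> \<sigma> x = u"
proof -
  have "\<sigma> x \<in> universe G \<and> (\<forall>u\<in>universe G. 2 * x \<in> set (\<chi> u) \<longleftrightarrow> u = \<sigma> x)"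
    using assms unfolding compatible_def by (elim conjE) (rule bspec)
  then show "\<sigma> x \<in> universe G" "u \<in> universe G \<Longrightarrow> 2 * x \<in> set (\<chi> u) \<longleftrightarrow> \<sigma> x = u"
    by (simp_all add: eq_commute)
qed

lemma compatible_fv2:
  assumes "compatible G \<phi> \<sigma> \<Theta> \<chi>" "X \<in> fv2 \<phi>"
  shows "\<Theta> X \<subseteq> universe G" "u \<in> universe G \<Longrightarrow> 2 * X + 1 \<in> set (\<chi> u) \<longleftrightarrow> u \<in> \<Theta> X"
proof -
  have "\<Theta> X \<subseteq> universe G \<and> (\<forall>u\<in>universe G. 2 * X + 1 \<in> set (\<chi> u) \<longleftrightarrow> u \<in> \<Theta> X)"
    using assms unfolding compatible_def by (elim conjE) (rule bspec)
  then show "\<Theta> X \<subseteq> universe G" "u \<in> universe G \<Longrightarrow> 2 * X + 1 \<in> set (\<chi> u) \<longleftrightarrow> u \<in> \<Theta> X"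
    by simp_all
qed

lemma trm_wf_0: "trm_wf 0 t \<Longrightarrow> \<exists>x. t = FV x"
  by (cases t) auto

text \<open>Quantifiers of normal forms range over all sets of the type, those of counting MSO over
  the universe; both quantifier cases pass from \<open>U\<close> to
  \<open>U \<inter> universe G\<close>.\<close>

lemma sat_iff_nfsat:
  assumes G: "finite (verts G)" "finite (edges G)" "\<And>e. e \<in> edges G \<Longrightarrow> set (inc G e) \<subseteq> verts G"
  shows "cmso_wf ar S 0 \<phi> \<Longrightarrow> compatible G \<phi> \<sigma> \<Theta> \<chi> \<Longrightarrow> sat G \<sigma> \<Theta> \<phi> \<longleftrightarrow> nfsat G \<chi> (to_nf \<phi>)"
proof (induction \<phi> arbitrary: \<sigma> \<Theta> \<chi>)
  case (Lab a t)
  then obtain x where t: "t = FV x" using trm_wf_0 by auto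
  have x: "2 * x \<in> set (\<chi> (Inr e)) \<longleftrightarrow> \<sigma> x = Inr e" if "e \<in> edges G" for e
    by (rule compatible_fv1[OF Lab.prems(2)]) (use that in \<open>simp_all add: t universe_def\<close>)
  show ?case
    unfolding sat.simps to_nf.simps nfsat_edge_nf[OF G(2)] t trm_val.simps trm_var.simps
    by (intro bex_cong refl) (auto simp: x)
next
  case (Inc i t u)
  then obtain x y where t: "t = FV x" "u = FV y" using trm_wf_0 by fastforce
  have x: "2 * x \<in> set (\<chi> (Inr e)) \<longleftrightarrow> \<sigma> x = Inr e" if "e \<in> edges G" for e
    by (rule compatible_fv1[OF Inc.prems(2)]) (use that in \<open>simp_all add: t universe_def\<close>)
  have y: "2 * y \<in> set (\<chi> (Inl v)) \<longleftrightarrow> \<sigma> y = Inl v" if "v \<in> verts G" for v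
    by (rule compatible_fv1[OF Inc.prems(2)]) (use that in \<open>simp_all add: t universe_def\<close>)
  have v: "inc G e ! (i - 1) \<in> verts G" if "e \<in> edges G" "1 \<le> i" "i \<le> length (inc G e)" for e
    using G(3)[OF that(1)] that(2,3) by (simp add: subset_eq)
  show ?case
    unfolding sat.simps to_nf.simps nfsat_edge_nf[OF G(2)] t trm_val.simps trm_var.simps
    by (intro bex_cong refl) (auto simp: x y v[simplified])
next
  case (Eq t u)
  then obtain x y where t: "t = FV x" "u = FV y" using trm_wf_0 by fastforce
  have fv: "x \<in> fv1 (Eq t u)" "y \<in> fv1 (Eq t u)" by (simp_all add: t)
  note c = compatible_fv1[OF Eq.prems(2) fv(1)] compatible_fv1[OF Eq.prems(2) fv(2)]
  show ?case
    unfolding sat.simps to_nf.simps nfsat_ex_nf[OF G(1,2)] unfolding t trm_val.simps trm_var.simps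
    using c by blast
next
  case (Mem t X)
  then obtain x where t: "t = FV x" using trm_wf_0 by auto
  have fv: "x \<in> fv1 (Mem t X)" "X \<in> fv2 (Mem t X)" by (simp_all add: t)
  note c = compatible_fv1[OF Mem.prems(2) fv(1)] compatible_fv2[OF Mem.prems(2) fv(2)]
  show ?case
    unfolding sat.simps to_nf.simps nfsat_ex_nf[OF G(1,2)] unfolding t trm_val.simps trm_var.simps
    using c by blast
next
  case (CardMod X k m)
  have fv: "X \<in> fv2 (CardMod X k m)" by simp
  note c = compatible_fv2[OF CardMod.prems(2) fv]
  have "{u \<in> universe G. 2 * X + 1 \<in> set (\<chi> u)} = \<Theta> X" using c by blast
  moreover have "finite (\<Theta> X)"
    using c(1) by (rule finite_subset) (simp add: universe_def G)
  ultimately show ?case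
    unfolding to_nf.simps nfsat_count_nf[OF G(1,2)] by (simp add: red_mod)
next
  case (Neg \<phi>)
  then show ?case by (simp add: compatible_def)
next
  case (Conj \<phi> \<psi>)
  have "compatible G \<phi> \<sigma> \<Theta> \<chi>" "compatible G \<psi> \<sigma> \<Theta> \<chi>"
    using Conj.prems(2) unfolding compatible_def by (simp_all add: ball_Un)
  then show ?case using Conj by simp
next
  case (Ex1 x \<phi>)
  have IH: "sat G (\<sigma>(x := u)) \<Theta> \<phi> \<longleftrightarrow> nfsat G (\<lambda>v. recolour (2 * x) (v \<in> U) (\<chi> v)) (to_nf \<phi>)"
    if "U \<inter> universe G = {u}" for u U
  proof (rule Ex1.IH)
    show "cmso_wf ar S 0 \<phi>" using Ex1.prems by simp
    \<comment> \<open>Even and odd variables never clash, so recolouring by \<open>2 * x\<close>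
      leaves the marks of set variables alone.\<close>
    have "2 * X + 1 \<noteq> 2 * x" for X by presburger
    then show "compatible G \<phi> (\<sigma>(x := u)) \<Theta> (\<lambda>v. recolour (2 * x) (v \<in> U) (\<chi> v))"
      using Ex1.prems(2) that by (auto simp: compatible_def set_recolour)
  qed
  have "{u \<in> universe G. 2 * x \<in> set (recolour (2 * x) (u \<in> U) (\<chi> u))} = U \<inter> universe G" for U
    by (auto simp: set_recolour)
  then have "nfsat G \<chi> (to_nf (Ex1 x \<phi>)) \<longleftrightarrow> (\<exists>U. card (U \<inter> universe G) = 1 \<and>
      nfsat G (\<lambda>v. recolour (2 * x) (v \<in> U) (\<chi> v)) (to_nf \<phi>))"
    unfolding to_nf.simps nfsat.simps nfsat_count_nf[OF G(1,2)] red_2_eq_1 by simp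
  also have "\<dots> \<longleftrightarrow> (\<exists>u\<in>universe G. sat G (\<sigma>(x := u)) \<Theta> \<phi>)"
  proof
    assume "\<exists>U. card (U \<inter> universe G) = 1 \<and> nfsat G (\<lambda>v. recolour (2 * x) (v \<in> U) (\<chi> v)) (to_nf \<phi>)"
    then obtain U u where "U \<inter> universe G = {u}" "nfsat G (\<lambda>v. recolour (2 * x) (v \<in> U) (\<chi> v)) (to_nf \<phi>)"
      by (auto simp: card_1_singleton_iff)
    then show "\<exists>u\<in>universe G. sat G (\<sigma>(x := u)) \<Theta> \<phi>" using IH by blast
  next
    assume "\<exists>u\<in>universe G. sat G (\<sigma>(x := u)) \<Theta> \<phi>"
    then obtain u where "u \<in> universe G" "sat G (\<sigma>(x := u)) \<Theta> \<phi>" by blast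
    then show "\<exists>U. card (U \<inter> universe G) = 1 \<and> nfsat G (\<lambda>v. recolour (2 * x) (v \<in> U) (\<chi> v)) (to_nf \<phi>)"
      using IH[of "{u}" u] by (intro exI[of _ "{u}"]) simp
  qed
  finally show ?case by simp
next
  case (Ex2 X \<phi>)
  have IH: "sat G \<sigma> (\<Theta>(X := U \<inter> universe G)) \<phi> \<longleftrightarrow>
      nfsat G (\<lambda>v. recolour (2 * X + 1) (v \<in> U) (\<chi> v)) (to_nf \<phi>)" for U
  proof (rule Ex2.IH)
    show "cmso_wf ar S 0 \<phi>" using Ex2.prems by simp
    have "2 * x \<noteq> 2 * X + 1" for x by presburger
    then show "compatible G \<phi> \<sigma> (\<Theta>(X := U \<inter> universe G)) (\<lambda>v. recolour (2 * X + 1) (v \<in> U) (\<chi> v))"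
      using Ex2.prems(2) by (auto simp: compatible_def set_recolour)
  qed
  have "(\<exists>U\<subseteq>universe G. sat G \<sigma> (\<Theta>(X := U)) \<phi>) \<longleftrightarrow> (\<exists>U. sat G \<sigma> (\<Theta>(X := U \<inter> universe G)) \<phi>)"
    by (metis Int_lower2 inf.orderE)
  then show ?case unfolding sat.simps to_nf.simps nfsat.simps IH .
qed

section \<open>Computability of the algebra\<close>

lemma computable_length [computable_intros]:
  assumes "computable l" shows "computable (\<lambda>x. length (l x))"
proof -
  have "computable (\<lambda>x. sum_list (map (\<lambda>_. 1 :: nat) (l x)))" by (intro computable_intros assms)
  then show ?thesis by (simp add: sum_list_triv)
qed

lemma computable_recolour [computable_intros]:
  assumes "computable b" "computable c" shows "computable (\<lambda>x. recolour X (b x) (c x))"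
  unfolding recolour_def by (intro computable_intros assms)

lemma computable_entry [computable_intros]:
  assumes "computable u" "computable t" shows "computable (\<lambda>x. entry (u x) (t x))"
  unfolding entry_def by (intro computable_intros assms)

section \<open>Finite sets coded as numbers\<close>

definition insert_code :: "nat \<Rightarrow> nat \<Rightarrow> nat" where
  "insert_code x s = (if x \<in> set_decode s then s else 2 ^ x + s)"

lemma set_decode_insert_code [simp]: "set_decode (insert_code x s) = insert x (set_decode s)"
  by (auto simp: insert_code_def set_decode_plus_power_2)

lemma computable_insert_code [computable_intros]:
  assumes "computable a" "computable b" shows "computable (\<lambda>x. insert_code (a x) (b x))"
  unfolding insert_code_def by (intro computable_intros assms)

lemma foldr_insert_code: "foldr (\<lambda>x s. insert_code x s) xs 0 = set_encode (set xs)"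
proof -
  have "set_decode (foldr (\<lambda>x s. insert_code x s) xs 0) = set xs" by (induction xs) auto
  then show ?thesis by (metis set_decode_inverse)
qed

text \<open>Searching below \<open>s\<close> loses nothing: a member \<open>x\<close> of the decoded
  set satisfies \<open>x < 2 ^ x\<close> and \<open>2 ^ x \<le> s\<close>.\<close>

definition elements_of_code :: "nat \<Rightarrow> nat list" where
  "elements_of_code s = filter (\<lambda>x. x \<in> set_decode s) [0..<s]"

lemma set_elements_of_code [simp]: "set (elements_of_code s) = set_decode s"
proof -
  have "x < s" if "x \<in> set_decode s" for x
  proof -
    have "set_decode (set_encode {x}) \<subseteq> set_decode s" using that by (subst set_encode_inverse) auto
    from subset_decode_imp_le[OF this] have "2 ^ x \<le> s" by simp
    then show ?thesis using less_exp[of x] by linarith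
  qed
  then show ?thesis by (auto simp: elements_of_code_def)
qed

lemma computable_elements_of_code [computable_intros]:
  assumes "computable a" shows "computable (\<lambda>x. elements_of_code (a x))"
  unfolding elements_of_code_def by (intro computable_intros assms computable_compose[OF assms])

text \<open>In the program, a choice of a vertex set is a recoloured vertex list; this reads the
  choice at one vertex back from the list.\<close>

definition holds :: "nat \<Rightarrow> (nat \<times> nat list) list \<Rightarrow> nat \<Rightarrow> bool" where
  "holds X vs v \<longleftrightarrow> filter (\<lambda>p. fst p = v \<and> X \<in> set (snd p)) vs \<noteq> []"

lemma computable_holds [computable_intros]:
  assumes "computable a" "computable b" shows "computable (\<lambda>x. holds X (a x) (b x))"
  unfolding holds_def by (intro computable_intros assms computable_compose[OF assms(2)])

text \<open>\<open>vs\<close> lists the vertices with their colours, \<open>es\<close> the hyperedges as pairs of label and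
  incidence list, \<open>ss\<close> the sources.\<close>

primrec eval_prog :: "'a nf \<Rightarrow> (nat \<times> nat list) list \<Rightarrow> (nat \<times> nat list) list \<Rightarrow> nat list \<Rightarrow> nat" where
  "eval_prog (Cnt wv we m F) vs es ss = red m (sum_list (map (\<lambda>p. fst p) es) +
     sum_list (map (\<lambda>p. if fst p \<in> set ss then 0 else wv (snd p)) vs))"
| "eval_prog (NNeg \<phi>) vs es ss = eval_prog \<phi> vs es ss"
| "eval_prog (NConj \<phi> \<psi>) vs es ss = prod_encode
     (eval_prog \<phi> vs (map (\<lambda>p. (fst (prod_decode (fst p)), snd p)) es) ss,
      eval_prog \<psi> vs (map (\<lambda>p. (snd (prod_decode (fst p)), snd p)) es) ss)"
| "eval_prog (NEx X \<phi>) vs es ss = foldr (\<lambda>x s. insert_code x s)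
     (concat (map (\<lambda>vs'. map (\<lambda>es'. entry (map (\<lambda>v. holds X vs' v) ss) (eval_prog \<phi> vs' es' ss))
         (product_lists (map (\<lambda>p. map (\<lambda>x. (snd (prod_decode x), snd p))
            (filter (\<lambda>x. fst (prod_decode x) = list_encode (map (\<lambda>v. of_bool (holds X vs' v)) (snd p)))
               (elements_of_code (fst p)))) es)))
       (product_lists (map (\<lambda>p. [(fst p, recolour X False (snd p)), (fst p, recolour X True (snd p))]) vs)))) 0"

lemma computable_apply3:
  assumes "computable (\<lambda>p. f (fst p) (fst (snd p)) (snd (snd p)))" "computable a" "computable b" "computable c"
  shows "computable (\<lambda>x. f (a x) (b x) (c x))"
  using computable_compose[OF assms(1) computable_Pair[OF assms(2) computable_Pair[OF assms(3,4)]]] by simp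

lemma computable_red [computable_intros]:
  assumes "computable a" shows "computable (\<lambda>x. red m (a x))"
  unfolding red_def by (intro computable_intros assms)

text \<open>The normal form is a fixed parameter, not an input: the recursion over it is carried out
  in the logic, and each normal form gets a program of its own.\<close>

lemma computable_eval_prog:
  "nf_ok \<phi> \<Longrightarrow> computable (\<lambda>p. eval_prog \<phi> (fst p) (fst (snd p)) (snd (snd p)))"
proof (induction \<phi>)
  case (Cnt wv we m F)
  then have wv: "computable wv" by simp
  show ?case unfolding eval_prog.simps by (intro computable_intros computable_compose[OF wv])
next
  case (NNeg \<phi>)
  then show ?case by simp
next
  case (NConj \<phi> \<psi>)
  then have "computable (\<lambda>p. eval_prog \<phi> (fst p) (fst (snd p)) (snd (snd p)))"
    "computable (\<lambda>p. eval_prog \<psi> (fst p) (fst (snd p)) (snd (snd p)))" by simp_all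
  note IH = this[THEN computable_apply3[where f = "eval_prog _"]]
  show ?case unfolding eval_prog.simps by (intro computable_intros IH)
next
  case (NEx X \<phi>)
  then have "computable (\<lambda>p. eval_prog \<phi> (fst p) (fst (snd p)) (snd (snd p)))" by simp
  note IH = this[THEN computable_apply3[where f = "eval_prog \<phi>"]]
  show ?case unfolding eval_prog.simps by (intro computable_intros IH)
qed

lemma product_lists_map:
  assumes "distinct xs"
  shows "set (product_lists (map f xs)) = {map g xs | g. \<forall>x\<in>set xs. g x \<in> set (f x)}"
proof -
  have "list_all2 (\<lambda>x ys. x \<in> set ys) zs (map f xs) \<longleftrightarrow> (\<exists>g. zs = map g xs \<and> (\<forall>x\<in>set xs. g x \<in> set (f x)))"
    for zs
  proof
    assume *: "list_all2 (\<lambda>x ys. x \<in> set ys) zs (map f xs)"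
    then have "length zs = length xs" by (auto dest: list_all2_lengthD)
    then obtain g where "zs = map g xs" using ex_map_eq[OF assms] by metis
    with * show "\<exists>g. zs = map g xs \<and> (\<forall>x\<in>set xs. g x \<in> set (f x))"
      by (auto simp: list.rel_map list_all2_same)
  qed (auto simp: list.rel_map list_all2_same)
  then show ?thesis by (auto simp: product_lists_set)
qed

lemma image_entries:
  "(\<lambda>x. (snd (prod_decode x), y)) ` {x \<in> S. fst (prod_decode x) = list_encode (map of_bool u)} =
    {(t, y) | t. entry u t \<in> S}"
proof (intro set_eqI iffI)
  fix z assume "z \<in> (\<lambda>x. (snd (prod_decode x), y)) ` {x \<in> S. fst (prod_decode x) = list_encode (map of_bool u)}"
  then obtain x where x: "x \<in> S" "fst (prod_decode x) = list_encode (map of_bool u)" "z = (snd (prod_decode x), y)"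
    by blast
  have "entry u (snd (prod_decode x)) = x" unfolding entry_def x(2)[symmetric] by simp
  then show "z \<in> {(t, y) | t. entry u t \<in> S}" using x by auto
next
  fix z assume "z \<in> {(t, y) | t. entry u t \<in> S}"
  then obtain t where "z = (t, y)" "entry u t \<in> S" by blast
  then show "z \<in> (\<lambda>x. (snd (prod_decode x), y)) ` {x \<in> S. fst (prod_decode x) = list_encode (map of_bool u)}"
    by (intro image_eqI[of _ _ "entry u t"]) (simp_all add: entry_def)
qed

text \<open>The program enumerates marks as recoloured vertex lists and, for each of them, values as
  relabelled hyperedge lists. By \<open>product_lists_map\<close> these are the choices
  \<open>d\<close> and \<open>t\<close> of \<open>evalnf\<close>, up to their irrelevant behaviour
  outside the hypergraph.\<close>

lemma eval_prog_correct:
  fixes G :: "(nat, 'e, 'x) hg"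
  assumes V: "set vl = verts G" "distinct vl" and E: "set el = edges G" "distinct el"
    and sub: "\<And>e. e \<in> edges G \<Longrightarrow> set (inc G e) \<subseteq> verts G" "set (srcs G) \<subseteq> verts G"
  shows "eval_prog \<phi> (map (\<lambda>v. (v, c v)) vl) (map (\<lambda>e. (l e, inc G e)) el) (srcs G) = evalnf \<phi> G l c"
proof (induction \<phi> arbitrary: l c)
  case (Cnt wv we m F)
  have "sum_list (map l el) = (\<Sum>e\<in>edges G. l e)"
    using E by (simp add: sum_list_distinct_conv_sum_set)
  moreover have "sum_list (map (\<lambda>v. if v \<in> set (srcs G) then 0 else wv (c v)) vl) =
      (\<Sum>v\<in>verts G. if v \<in> set (srcs G) then 0 else wv (c v))"
    using V by (simp add: sum_list_distinct_conv_sum_set)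
  moreover have "\<dots> = (\<Sum>v\<in>verts G - set (srcs G). wv (c v))"
  proof -
    have "finite (verts G)" using V by (metis List.finite_set)
    then show ?thesis by (intro sum.mono_neutral_cong_right) auto
  qed
  ultimately show ?case by (simp add: comp_def cong: if_cong)
next
  case (NConj \<phi> \<psi>)
  then show ?case by (simp add: comp_def)
next
  case (NEx X \<phi>)
  define VS where "VS = (\<lambda>d. map (\<lambda>v. (v, recolour X (d v) (c v))) vl)"
  define ES where "ES = (\<lambda>t. map (\<lambda>e. (t e :: nat, inc G e)) el)"
  \<comment> \<open>\<open>recolour\<close> settles the mark \<open>X\<close> irrespective of the
    old colour, so \<open>d\<close> can be read off.\<close>
  have holds: "holds X (VS d) v \<longleftrightarrow> d v" if "v \<in> verts G" for d v
    using that V by (auto simp: holds_def VS_def filter_empty_conv set_recolour split: if_splits)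
  have vs: "set (product_lists (map (\<lambda>p. [(fst p, recolour X False (snd p)), (fst p, recolour X True (snd p))])
      (map (\<lambda>v. (v, c v)) vl))) = range VS" (is "?A = _")
  proof -
    have "?A = {map g vl | g. \<forall>v\<in>set vl. g v \<in> {(v, recolour X False (c v)), (v, recolour X True (c v))}}"
      unfolding map_map comp_def product_lists_map[OF V(2)] by simp
    also have "\<dots> = range VS"
    proof (intro set_eqI iffI)
      fix zs assume "zs \<in> {map g vl | g. \<forall>v\<in>set vl. g v \<in> {(v, recolour X False (c v)), (v, recolour X True (c v))}}"
      then obtain g where g: "zs = map g vl" "\<forall>v\<in>set vl. g v \<in> {(v, recolour X False (c v)), (v, recolour X True (c v))}"
        by blast
      \<comment> \<open>A choice function becomes a vertex predicate by asking where it takes the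
        positive colour.\<close>
      have "g v = (v, recolour X (g v = (v, recolour X True (c v))) (c v))" if "v \<in> set vl" for v
        using g(2) that by (cases "g v = (v, recolour X True (c v))") auto
      then have "zs = VS (\<lambda>v. g v = (v, recolour X True (c v)))" by (simp add: VS_def g(1))
      then show "zs \<in> range VS" by blast
    next
      fix zs assume "zs \<in> range VS"
      then obtain d where "zs = VS d" by blast
      moreover have "(v, recolour X (d v) (c v)) \<in> {(v, recolour X False (c v)), (v, recolour X True (c v))}" for v
        by (cases "d v") auto
      ultimately show "zs \<in> {map g vl | g. \<forall>v\<in>set vl. g v \<in> {(v, recolour X False (c v)), (v, recolour X True (c v))}}"
        unfolding VS_def by blast
    qed
    finally show ?thesis .
  qed
  have es: "set (product_lists (map (\<lambda>p. map (\<lambda>x. (snd (prod_decode x), snd p))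
            (filter (\<lambda>x. fst (prod_decode x) = list_encode (map (\<lambda>v. of_bool (holds X (VS d) v)) (snd p)))
               (elements_of_code (fst p)))) (map (\<lambda>e. (l e, inc G e)) el))) =
      {ES t | t. \<forall>e\<in>edges G. entry (map d (inc G e)) (t e) \<in> set_decode (l e)}" (is "?A = _") for d
  proof -
    define B where "B = (\<lambda>e. {(t :: nat, inc G e) | t. entry (map d (inc G e)) t \<in> set_decode (l e)})"
    have mh: "map (\<lambda>v. of_bool (holds X (VS d) v)) (inc G e) = (map of_bool (map d (inc G e)) :: nat list)"
      if "e \<in> edges G" for e
      using sub(1)[OF that] holds by auto
    have "(\<lambda>x. (snd (prod_decode x), inc G e)) ` {x \<in> set_decode (l e).
          fst (prod_decode x) = list_encode (map (\<lambda>v. of_bool (holds X (VS d) v)) (inc G e))} = B e"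
      if "e \<in> edges G" for e
      unfolding mh[OF that] B_def by (rule image_entries)
    then have "?A = {map g el | g. \<forall>e\<in>edges G. g e \<in> B e}"
      unfolding map_map comp_def product_lists_map[OF E(2)] by (simp add: E(1) Int_def conj_commute set_filter)
    also have "\<dots> = {ES t | t. \<forall>e\<in>edges G. entry (map d (inc G e)) (t e) \<in> set_decode (l e)}"
    proof (intro set_eqI iffI)
      fix zs assume "zs \<in> {map g el | g. \<forall>e\<in>edges G. g e \<in> B e}"
      then obtain g where g: "zs = map g el" "\<forall>e\<in>edges G. g e \<in> B e" by blast
      then have "zs = ES (\<lambda>e. fst (g e))" using E(1) by (auto simp: ES_def B_def)
      moreover have "\<forall>e\<in>edges G. entry (map d (inc G e)) (fst (g e)) \<in> set_decode (l e)"
        using g(2) by (auto simp: B_def)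
      ultimately show "zs \<in> {ES t | t. \<forall>e\<in>edges G. entry (map d (inc G e)) (t e) \<in> set_decode (l e)}"
        by blast
    next
      fix zs assume "zs \<in> {ES t | t. \<forall>e\<in>edges G. entry (map d (inc G e)) (t e) \<in> set_decode (l e)}"
      then show "zs \<in> {map g el | g. \<forall>e\<in>edges G. g e \<in> B e}"
        unfolding ES_def B_def by blast
    qed
    finally show ?thesis .
  qed
  have val: "eval_prog \<phi> (VS d) (ES t) (srcs G) = evalnf \<phi> G t (\<lambda>v. recolour X (d v) (c v))" for d t
    unfolding VS_def ES_def by (rule NEx.IH)
  have UN: "(\<Union>d. F d ` {ES t | t. C d t}) = {F d (ES t) | d t. C d t}"
    for F :: "(nat \<Rightarrow> bool) \<Rightarrow> _ \<Rightarrow> nat" and C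
    by blast
  have ms: "map (\<lambda>v. holds X (VS d) v) (srcs G) = map d (srcs G)" for d
    using sub(2) holds by auto
  show ?case
    unfolding eval_prog.simps evalnf.simps foldr_insert_code
    by (rule arg_cong[of _ _ set_encode]) (simp only: set_concat set_map vs image_image es ms UN val)
qed simp_all

section \<open>Enumeration of the values of a given arity\<close>

primrec vals_prog :: "'a nf \<Rightarrow> nat \<Rightarrow> nat list" where
  "vals_prog (Cnt wv we m F) n = [0..<2 * m]"
| "vals_prog (NNeg \<phi>) n = vals_prog \<phi> n"
| "vals_prog (NConj \<phi> \<psi>) n =
     concat (map (\<lambda>s. map (\<lambda>t. prod_encode (s, t)) (vals_prog \<psi> n)) (vals_prog \<phi> n))"
| "vals_prog (NEx X \<phi>) n = foldr (\<lambda>x ss. ss @ map (\<lambda>s. insert_code x s) ss)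
     (concat (map (\<lambda>u. map (\<lambda>t. entry u t) (vals_prog \<phi> n)) (product_lists (map (\<lambda>_. [False, True]) [0..<n])))) [0]"

lemma computable_vals_prog: "computable (\<lambda>n. vals_prog \<phi> n)"
proof (induction \<phi>)
  case (Cnt wv we m F)
  show ?case unfolding vals_prog.simps by (intro computable_intros)
next
  case (NNeg \<phi>)
  then show ?case by simp
next
  case (NConj \<phi> \<psi>)
  show ?case
    unfolding vals_prog.simps
    by (intro computable_intros computable_compose[OF NConj.IH(1)] computable_compose[OF NConj.IH(2)])
next
  case (NEx X \<phi>)
  show ?case
    unfolding vals_prog.simps
    by (intro computable_intros computable_compose[OF NEx.IH])
qed

text \<open>Each \<open>x\<close> doubles the list by the subsets that contain it; the code of a set
  with \<open>x\<close> arises from that of the set with \<open>x\<close> removed.\<close>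

lemma set_foldr_insert_code:
  "set (foldr (\<lambda>x ss. ss @ map (\<lambda>s. insert_code x s) ss) xs [0]) = {s. set_decode s \<subseteq> set xs}"
proof (induction xs)
  case Nil
  have "s = 0" if "set_decode s = {}" for s using that set_decode_inverse[of s] by simp
  then show ?case by auto
next
  case (Cons x xs)
  have "s \<in> insert_code x ` {s. set_decode s \<subseteq> set xs}" if "set_decode s \<subseteq> insert x (set xs)" "x \<in> set_decode s" for s
  proof (rule image_eqI)
    have "set_decode (insert_code x (set_encode (set_decode s - {x}))) = set_decode s" using that by auto
    then show "s = insert_code x (set_encode (set_decode s - {x}))" by (metis set_decode_inverse)
  qed (use that in auto)
  then show ?case using Cons by (auto simp: image_iff)
qed

lemma set_vals_prog: "set (vals_prog \<phi> n) = vals \<phi> n"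
proof (induction \<phi>)
  case (NEx X \<phi>)
  have "set (product_lists (map (\<lambda>_. [False, True]) [0..<n])) = {u. length u = n}"
  proof -
    have "\<exists>g. u = map g [0..<n]" if "length u = n" for u :: "bool list"
      using map_nth[of u] that by metis
    then show ?thesis by (auto simp: product_lists_map)
  qed
  then have "set (concat (map (\<lambda>u. map (\<lambda>t. entry u t) (vals_prog \<phi> n))
      (product_lists (map (\<lambda>_. [False, True]) [0..<n])))) =
      {entry u t | u t. length u = n \<and> t \<in> vals \<phi> n}"
    using NEx by auto
  then show ?case unfolding vals_prog.simps set_foldr_insert_code vals.simps by simp
qed (auto simp: image_iff)

lemma computable_rf1:
  assumes "computable (f :: nat \<Rightarrow> nat)" shows "\<exists>p. \<forall>x. rf_eval p [x] (f x)"
proof -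
  obtain g where "recursive 1 g" "\<And>x. f x = g [x]" using assms unfolding computable_def by auto
  then obtain p where "\<And>xs. length xs = 1 \<Longrightarrow> rf_eval p xs (g xs)" "\<And>x. f x = g [x]"
    unfolding recursive_def by blast
  then have "rf_eval p [x] (f x)" for x by simp
  then show ?thesis by blast
qed

text \<open>Bridges two conventions: the enumeration program of an algebra receives a list of two
  numbers, \<open>computable\<close> one coded pair.\<close>

lemma computable_rf2:
  assumes "computable (\<lambda>p. f (fst p) (snd p) :: nat)" shows "\<exists>p. \<forall>x y. rf_eval p [x, y] (f x y)"
proof -
  obtain g where g: "recursive 1 g" "\<And>p. f (fst p) (snd p) = g [cod p]" using assms unfolding computable_def by auto
  have "recursive 2 (\<lambda>xs. g (map (\<lambda>h. h xs) [\<lambda>xs. prod_encode (xs ! 0, xs ! 1)]))"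
    using g(1) by (intro recursive_compose) (auto intro!: recursive_prod_encode recursive_nth)
  then obtain p where p: "\<And>xs. length xs = 2 \<Longrightarrow> rf_eval p xs (g [prod_encode (xs ! 0, xs ! 1)])"
    unfolding recursive_def by auto
  have "rf_eval p [x, y] (f x y)" for x y
    using p[of "[x, y]"] g(2)[of "(x, y)"] by simp
  then show ?thesis by blast
qed

section \<open>The algebra of a normal form\<close>

lemma hg_map_simps [simp]:
  "verts (hg_map h G) = verts G" "edges (hg_map h G) = edges G" "lab (hg_map h G) = h \<circ> lab G"
  "inc (hg_map h G) = inc G" "srcs (hg_map h G) = srcs G"
  by (simp_all add: hg_map_def)

lemma evalnf_hg_map [simp]: "evalnf \<phi> (hg_map h G) l c = evalnf \<phi> G l c"
  by (induction \<phi> arbitrary: l c) simp_all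

lemma wf_hg_hg_map:
  "wf_hg ar S G \<Longrightarrow> (\<And>a. a \<in> S \<Longrightarrow> g a \<in> A \<and> arA (g a) = ar a) \<Longrightarrow> wf_hg arA A (hg_map g G)"
  by (auto simp: wf_hg_def)

lemma hg_iso_hg_map:
  assumes "hg_iso G H" shows "hg_iso (hg_map g G) (hg_map g H)"
proof -
  obtain fv fe where "bij_betw fv (verts G) (verts H)" "bij_betw fe (edges G) (edges H)"
      "\<forall>e\<in>edges G. lab H (fe e) = lab G e \<and> inc H (fe e) = map fv (inc G e)" "srcs H = map fv (srcs G)"
    using assms unfolding hg_iso_def by blast
  then show ?thesis unfolding hg_iso_def by (intro exI[of _ fv] exI[of _ fe]) simp
qed

text \<open>Mapping labels commutes with flattening, so associativity of the product turns every
  arity-preserving assignment of letters into a homomorphism.\<close>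

lemma H_hom_free_extension:
  fixes ar :: "'a \<Rightarrow> nat" and S :: "'a set" and pi :: "'b H \<Rightarrow> 'b"
  assumes alg: "H_algebra A arA pi" and g: "\<And>a. a \<in> S \<Longrightarrow> g a \<in> A \<and> arA (g a) = ar a"
  shows "H_hom_free ar S A arA pi (\<lambda>G. pi (hg_map g G))"
proof -
  have wf: "wf_hg arA A (hg_map g G)" if "wf_hg ar S G" for G :: "'a H"
    using that g by (rule wf_hg_hg_map)
  have "pi (hg_map g F) = pi (hg_map (\<lambda>G. pi (hg_map g G)) G)"
    if G: "wf_hg hg_arity {K. wf_hg ar S K} G" and F: "wf_hg ar S F" and i: "hg_iso F (flatten G)"
    for G :: "('a H) H" and F
  proof -
    have "hg_map g (flatten G) = flatten (hg_map (hg_map g) G)"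
      by (simp add: flatten_def hg_map_def comp_def fun_eq_iff)
    then have "hg_iso (hg_map g F) (flatten (hg_map (hg_map g) G))" using hg_iso_hg_map[OF i] by metis
    moreover have "wf_hg hg_arity {K. wf_hg arA A K} (hg_map (hg_map g) G)"
      using G wf by (auto simp: wf_hg_def[of hg_arity])
    ultimately have "pi (hg_map g F) = pi (hg_map pi (hg_map (hg_map g) G))"
      using alg wf[OF F] unfolding H_algebra_def by blast
    then show ?thesis by (simp add: hg_map_def comp_def)
  qed
  moreover have "pi (hg_map g G) \<in> A \<and> arA (pi (hg_map g G)) = hg_arity G" if "wf_hg ar S G" for G
    using alg wf[OF that] by (simp add: H_algebra_def)
  moreover have "pi (hg_map g G) = pi (hg_map g G')"
    if "wf_hg ar S G" "wf_hg ar S G'" "hg_iso G G'" for G G'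
    using alg wf[OF that(1)] wf[OF that(2)] hg_iso_hg_map[OF that(3)] unfolding H_algebra_def by blast
  ultimately show ?thesis unfolding H_hom_free_def by simp
qed

context
  fixes \<phi> :: "'a nf"
begin

text \<open>Values of different arities may coincide as numbers; pairing with the arity keeps the
  fibres apart.\<close>

definition nf_carrier :: "nat set" where
  "nf_carrier = {prod_encode (n, t) | n t. t \<in> vals \<phi> n}"

definition nf_arity :: "nat \<Rightarrow> nat" where
  "nf_arity a = fst (prod_decode a)"

definition nf_product :: "nat H \<Rightarrow> nat" where
  "nf_product G = prod_encode (length (srcs G), evalnf \<phi> G (\<lambda>e. snd (prod_decode (lab G e))) (\<lambda>_. []))"

lemma nf_labelling:
  assumes "wf_hg nf_arity nf_carrier G" shows "labelling \<phi> G (\<lambda>e. snd (prod_decode (lab G e)))"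
  using assms by (fastforce simp: labelling_def wf_hg_def nf_carrier_def nf_arity_def)

lemma nf_iso:
  fixes G :: "('v, 'e, nat) hg"
  assumes "wf_hg nf_arity nf_carrier G" "hg_iso G H"
  shows "evalnf \<phi> H (\<lambda>e. snd (prod_decode (lab H e))) (\<lambda>_. []) = evalnf \<phi> G (\<lambda>e. snd (prod_decode (lab G e))) (\<lambda>_. [])"
    "length (srcs H) = length (srcs G)"
proof -
  obtain fv fe where f: "bij_betw fv (verts G) (verts H)" "bij_betw fe (edges G) (edges H)"
      "\<And>e. e \<in> edges G \<Longrightarrow> lab H (fe e) = lab G e \<and> inc H (fe e) = map fv (inc G e)"
      "srcs H = map fv (srcs G)"
    using assms(2) unfolding hg_iso_def by blast
  have "evalnf \<phi> H (\<lambda>e. snd (prod_decode (lab H e))) (\<lambda>_. []) =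
      evalnf \<phi> G (\<lambda>e. snd (prod_decode (lab H (fe e)))) (\<lambda>_. [])"
    using assms(1) f by (intro evalnf_iso) (auto simp: wf_hg_def)
  also have "\<dots> = evalnf \<phi> G (\<lambda>e. snd (prod_decode (lab G e))) (\<lambda>_. [])"
    using f by (intro evalnf_cong) auto
  finally show "evalnf \<phi> H (\<lambda>e. snd (prod_decode (lab H e))) (\<lambda>_. []) =
    evalnf \<phi> G (\<lambda>e. snd (prod_decode (lab G e))) (\<lambda>_. [])" .
  show "length (srcs H) = length (srcs G)" using f by simp
qed

lemma nf_H_algebra:
  assumes ok: "nf_ok \<phi>" shows "H_algebra nf_carrier nf_arity nf_product"
  unfolding H_algebra_def
proof (intro conjI allI impI ballI)
  fix G :: "nat H" assume "wf_hg nf_arity nf_carrier G"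
  from evalnf_in_vals[OF ok nf_labelling[OF this]]
  show "nf_product G \<in> nf_carrier" by (auto simp: nf_product_def nf_carrier_def)
  show "nf_arity (nf_product G) = hg_arity G" by (simp add: nf_product_def nf_arity_def)
next
  fix G G' :: "nat H" assume "wf_hg nf_arity nf_carrier G \<and> wf_hg nf_arity nf_carrier G' \<and> hg_iso G G'"
  then show "nf_product G = nf_product G'" using nf_iso[of G G'] by (simp add: nf_product_def)
next
  fix a assume "a \<in> nf_carrier"
  then obtain n t where a: "a = prod_encode (n, t)" "t \<in> vals \<phi> n" by (auto simp: nf_carrier_def)
  have "evalnf \<phi> (hg_unit nf_arity a) (\<lambda>e. snd (prod_decode (lab (hg_unit nf_arity a) e))) (\<lambda>_. []) = t"
    by (subst evalnf_unit[where e = 0]) (use ok a in \<open>auto simp: hg_unit_def nf_arity_def\<close>)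
  then show "nf_product (hg_unit nf_arity a) = a"
    by (simp add: nf_product_def) (simp add: hg_unit_def nf_arity_def a)
next
  fix G :: "(nat H) H" and F :: "nat H"
  assume *: "wf_hg hg_arity {K. wf_hg nf_arity nf_carrier K} G \<and> wf_hg nf_arity nf_carrier F \<and> hg_iso F (flatten G)"
  have G: "finite (verts G)" "finite (edges G)"
    "\<And>e. e \<in> edges G \<Longrightarrow> wf_hg nf_arity nf_carrier (lab G e) \<and> length (inc G e) = length (srcs (lab G e))"
    using * by (auto simp: wf_hg_def[of hg_arity])
  have "labelling \<phi> (flatten G) (\<lambda>p. snd (prod_decode (lab (flatten G) p)))"
    using nf_labelling G(3) by (auto simp: labelling_def flatten_simps)
  then have "evalnf \<phi> (flatten G) (\<lambda>p. snd (prod_decode (lab (flatten G) p))) (\<lambda>_. []) =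
     evalnf \<phi> G (\<lambda>e. evalnf \<phi> (lab G e) (\<lambda>f. snd (prod_decode (lab (flatten G) (e, f)))) (\<lambda>_. [])) (\<lambda>_. [])"
    using G by (intro evalnf_flatten ok) (auto simp: wf_hg_def[of nf_arity])
  then show "nf_product F = nf_product (hg_map nf_product G)"
    using nf_iso[of F "flatten G"] * by (simp add: nf_product_def flatten_simps)
qed

lemma nf_fibre: "{a \<in> nf_carrier. nf_arity a = n} = (\<lambda>t. prod_encode (n, t)) ` vals \<phi> n"
  by (auto simp: nf_carrier_def nf_arity_def)

lemma nf_finite: "finite_on_every_arity nf_carrier nf_arity"
  unfolding finite_on_every_arity_def nf_fibre by (simp add: finite_vals)

lemma nf_enumerable:
  "\<exists>p. \<forall>n.
     (\<forall>i \<ge> 1. \<exists>r. rf_eval p [n, i] r \<and> (r = 0 \<or> (\<exists>a \<in> nf_carrier. nf_arity a = n \<and> r = Suc a))) \<and>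
     (\<forall>i j r. 1 \<le> i \<longrightarrow> i \<le> j \<longrightarrow> rf_eval p [n, j] (Suc r) \<longrightarrow> \<not> rf_eval p [n, i] 0) \<and>
     (\<forall>i j r. 1 \<le> i \<longrightarrow> 1 \<le> j \<longrightarrow> rf_eval p [n, i] (Suc r) \<longrightarrow> rf_eval p [n, j] (Suc r) \<longrightarrow> i = j) \<and>
     (\<forall>a \<in> nf_carrier. nf_arity a = n \<longrightarrow> (\<exists>i \<ge> 1. rf_eval p [n, i] (Suc a)))"
proof -
  define es where "es = (\<lambda>n. map (\<lambda>t. prod_encode (n, t)) (remdups (vals_prog \<phi> n)))"
  \<comment> \<open>Indices start at 1; output 0 signals that the list is exhausted, so elements are
    shifted by a successor.\<close>
  define P where "P = (\<lambda>n i. case drop (i - 1) (es n) of [] \<Rightarrow> 0 | y # ys \<Rightarrow> Suc y)"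
  have "computable (\<lambda>p. P (fst p) (snd p))"
    unfolding P_def es_def by (intro computable_intros computable_compose[OF computable_vals_prog])
  then obtain p where p: "\<And>n i. rf_eval p [n, i] (P n i)" using computable_rf2 by blast
  then have ev: "rf_eval p [n, i] r \<longleftrightarrow> r = P n i" for n i r
    using rf_eval_deterministic by blast
  have P: "P n i = (if i - 1 < length (es n) then Suc (es n ! (i - 1)) else 0)" for n i
    by (auto simp: P_def Cons_nth_drop_Suc[symmetric])
  have set_es: "set (es n) = {a \<in> nf_carrier. nf_arity a = n}" for n
    unfolding nf_fibre es_def by (simp add: set_vals_prog)
  have dist: "distinct (es n)" for n
    by (simp add: es_def distinct_map inj_on_def)
  show ?thesis
  proof (intro exI[of _ p] allI conjI impI ballI, unfold ev)
    fix n i :: nat assume "1 \<le> i"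
    show "\<exists>r. r = P n i \<and> (r = 0 \<or> (\<exists>a\<in>nf_carrier. nf_arity a = n \<and> r = Suc a))"
      using nth_mem[of "i - 1" "es n"] unfolding P set_es by auto
  next
    fix n i j r :: nat assume "1 \<le> i" "i \<le> j" "Suc r = P n j"
    then show "\<not> 0 = P n i" by (auto simp: P split: if_splits)
  next
    fix n i j r :: nat assume "1 \<le> i" "1 \<le> j" "Suc r = P n i" "Suc r = P n j"
    then have "i - 1 = j - 1"
      using nth_eq_iff_index_eq[OF dist[of n], of "i - 1" "j - 1"] by (auto simp: P split: if_splits)
    then show "i = j" using \<open>1 \<le> i\<close> \<open>1 \<le> j\<close> by simp
  next
    fix n a assume "a \<in> nf_carrier" "nf_arity a = n"
    then have "a \<in> set (es n)" by (simp add: set_es)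
    then obtain i where "i < length (es n)" "es n ! i = a" by (auto simp: in_set_conv_nth)
    then show "\<exists>i\<ge>1. Suc a = P n i" by (intro exI[of _ "Suc i"]) (simp add: P)
  qed
qed

lemma nf_product_computable:
  assumes "nf_ok \<phi>"
  shows "\<exists>q. \<forall>G. wf_hg nf_arity nf_carrier G \<longrightarrow> rf_eval q [enc_hg (\<lambda>a. a) G] (nf_product G)"
proof -
  define part where "part = (\<lambda>k n. case drop k (list_decode n) of [] \<Rightarrow> 0 | y # ys \<Rightarrow> y)"
  have part: "computable (\<lambda>x. part k (a x))" if "computable a" for k and a :: "'z::codable \<Rightarrow> nat"
    unfolding part_def by (intro computable_intros that)
  \<comment> \<open>On the whole code, parts 0, 1 and 2 are vertices, hyperedges and sources; within
    a hyperedge triple, part 1 is the label and part 2 the incidence list. The arity stored in a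
    label is dropped, and all vertices start with the empty colour.\<close>
  define q where "q = (\<lambda>n. prod_encode (length (list_decode (part 2 n)),
      eval_prog \<phi> (map (\<lambda>v. (v, [])) (list_decode (part 0 n)))
       (map (\<lambda>x. (snd (prod_decode (part 1 x)), list_decode (part 2 x))) (list_decode (part 1 n)))
       (list_decode (part 2 n))))"
  have "computable q"
    unfolding q_def
    by (intro computable_intros part
        computable_apply3[where f = "eval_prog \<phi>", OF computable_eval_prog[OF assms]])
  then obtain r where r: "\<And>n. rf_eval r [n] (q n)" using computable_rf1 by blast
  have "q (enc_hg (\<lambda>a. a) G) = nf_product G" if "wf_hg nf_arity nf_carrier G" for G
  proof -
    have "eval_prog \<phi> (map (\<lambda>v. (v, [])) (sorted_list_of_set (verts G)))
        (map (\<lambda>e. (snd (prod_decode (lab G e)), inc G e)) (sorted_list_of_set (edges G))) (srcs G) =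
      evalnf \<phi> G (\<lambda>e. snd (prod_decode (lab G e))) (\<lambda>_. [])"
      using that by (intro eval_prog_correct) (auto simp: wf_hg_def)
    then show ?thesis
      by (simp add: q_def enc_hg_def part_def comp_def nf_product_def numeral_2_eq_2)
  qed
  then show ?thesis using r by metis
qed

end

theorem theorem4p24:
  fixes ar :: "'a \<Rightarrow> nat" and \<Sigma> :: "'a set" and L :: "'a H set"
  assumes "finite \<Sigma>"
    and "cmso2_definable ar \<Sigma> L"
  shows "\<exists>(A :: nat set) arA pi. computable_H_algebra A arA pi \<and> finite_on_every_arity A arA
            \<and> recognised_by ar \<Sigma> L A arA pi"
proof -
  obtain \<psi> where \<psi>: "cmso_wf ar \<Sigma> 0 \<psi>" "fv1 \<psi> = {}" "fv2 \<psi> = {}" and L: "L = {G \<in> H0 ar \<Sigma>. models G \<psi>}"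
    using assms(2) unfolding cmso2_definable_def cmso_sentence_def by blast
  define \<phi> where "\<phi> = to_nf \<psi>"
  have ok: "nf_ok \<phi>" unfolding \<phi>_def using \<psi>(1) by (rule nf_ok_to_nf)
  let ?A = "nf_carrier \<phi>" and ?pi = "nf_product \<phi>"
  have "computable_H_algebra ?A nf_arity ?pi"
    unfolding computable_H_algebra_def
    using nf_H_algebra[OF ok] nf_enumerable[of \<phi>] nf_product_computable[OF ok]
    by (intro conjI exI[of _ "\<lambda>a. a"]) simp_all
  moreover have "recognised_by ar \<Sigma> L ?A nf_arity ?pi"
  proof -
    \<comment> \<open>A letter is evaluated with an unmarked hyperedge and unmarked vertices,
      matching the empty colours in \<open>nf_product\<close>.\<close>
    define g where "g = (\<lambda>a. prod_encode (ar a, letter \<phi> a [] (replicate (ar a) [])))"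
    have "g a \<in> ?A \<and> nf_arity (g a) = ar a" for a
      using letter_in_vals[OF ok, of a "[]" "replicate (ar a) []"]
      by (auto simp: g_def nf_carrier_def nf_arity_def)
    then have hom: "H_hom_free ar \<Sigma> ?A nf_arity ?pi (\<lambda>G. ?pi (hg_map g G))"
      by (intro H_hom_free_extension nf_H_algebra ok)
    have "models G \<psi> \<longleftrightarrow> accepts \<phi> (snd (prod_decode (?pi (hg_map g G))))" if "G \<in> H0 ar \<Sigma>" for G
    proof -
      have G: "wf_hg ar \<Sigma> G" "srcs G = []" using that by (auto simp: H0_def)
      \<comment> \<open>A sentence has no free variables, so the empty colouring is compatible with
        the default valuations of \<open>models\<close>.\<close>
      have "models G \<psi> \<longleftrightarrow> nfsat G (\<lambda>_. []) \<phi>"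
        unfolding models_def \<phi>_def using G(1) \<psi>
        by (intro sat_iff_nfsat) (auto simp: wf_hg_def compatible_def)
      also have "\<dots> \<longleftrightarrow> accepts \<phi> (evalnf \<phi> G
          (\<lambda>e. letter \<phi> (lab G e) [] (map (\<lambda>v. []) (inc G e))) (\<lambda>v. []))"
        using G by (intro nfsat_iff_accepts ok) (auto simp: wf_hg_def)
      also have "evalnf \<phi> G (\<lambda>e. letter \<phi> (lab G e) [] (map (\<lambda>v. []) (inc G e))) (\<lambda>v. []) =
          evalnf \<phi> G (\<lambda>e. snd (prod_decode (g (lab G e)))) (\<lambda>v. [])"
        using G by (intro evalnf_cong) (auto simp: g_def map_replicate_const wf_hg_def)
      finally show ?thesis by (simp add: nf_product_def)
    qed
    then show ?thesis
      unfolding recognised_by_def L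
      by (intro exI[of _ "\<lambda>G. ?pi (hg_map g G)"] exI[of _ "{a. accepts \<phi> (snd (prod_decode a))}"] conjI hom) auto
  qed
  ultimately show ?thesis using nf_finite by blast
qed

end
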